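(* Let $n,m\ge 1$ be integers with $n+m>2$ and let $\mathbf b\in\mathbb R^m$. Then the divergent part of Schmidt's theorem, statement (S), implies statement (T), where: (S) For every function $\Psi:\mathbb Z^n\to\{x\in\mathbb R:x\ge 0\}$ with $\Psi(\mathbf a)\to 0$ as $|\mathbf a|\to\infty$ and $\sum_{\mathbf a\in\mathbb Z^n}\Psi(\mathbf a)^m=\infty$, the set $W_{n,m}^{\mathbf b}(\Psi)$ has $nm$-dimensional Lebesgue measure $1$. (T) For every function $\Psi:\mathbb Z^n\to\{x\in\mathbb R:x\ge 0\}$ with $\Psi(\mathbf a)\to 0$ as $|\mathbf a|\to\infty$, and every dimension function $f$ such that $r\mapsto r^{-nm}f(r)$ is monotonic and $g:r\mapsto r^{-(n-1)m}f(r)$ is a dimension function, if $$\sum_{\mathbf a\in\mathbb Z^n\setminus\{\mathbf 0\}} g\!\left(\frac{\Psi(\mathbf a)}{|\mathbf a|}\right)|\mathbf a|^m=\infty,$$ then $\mathcal H^f\big(W_{n,m}^{\mathbf b}(\Psi)\big)=\mathcal H^f\big([0,1)^{n\times m}\big)$.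
   Context: For $\mathbf a=(a_1,\dots,a_n)\in\mathbb Z^n$, $|\mathbf a|:=\max(|a_1|,\dots,|a_n|)$. For $x\in\mathbb R$, $\|x\|$ is the distance from $x$ to the nearest integer, and $\mathbf x\cdot\mathbf y=x_1y_1+\dots+x_ny_n$ for $\mathbf x,\mathbf y\in\mathbb R^n$. For $\mathbf b=(b_1,\dots,b_m)$, $W_{n,m}^{\mathbf b}(\Psi)$ is the set of $X=(\mathbf x_1,\dots,\mathbf x_m)\in[0,1)^{n\times m}$ (with $\mathbf x_j\in\mathbb R^n$) such that the system $\|\mathbf a\cdot\mathbf x_j-b_j\|<\Psi(\mathbf a)$ for all $1\le j\le m$ is satisfied for infinitely many $\mathbf a\in\mathbb Z^n$. Here $[0,1)^{n\times m}$ is viewed as a subset of $\mathbb R^{n\times m}\cong\mathbb R^{nm}$. A dimension function is a continuous, non-decreasing function $f:\{x\ge 0\}\to\{x\ge 0\}$ with $f(r)\to 0$ as $r\to 0$. The function $g$ is given by the stated formula for $r>0$ and $g(0):=0$. Hausdorff $f$-measure: for $F\subset\mathbb R^k$ and $\rho>0$, $\mathcal H^f_\rho(F):=\inf\sum_i f(r(B_i))$, the infimum being over all countable collections of balls $B_i$ in $\mathbb R^k$ of radii $r(B_i)\le\rho$ covering $F$; and $\mathcal H^f(F):=\lim_{\rho\to 0}\mathcal H^f_\rho(F)=\sup_{\rho>0}\mathcal H^f_\rho(F)$. *)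

theory Defs
  imports "HOL-Analysis.Analysis"
begin

section \<open>Integer vectors and distance to the nearest integer\<close>

definition real_vec :: "int ^ 'n \<Rightarrow> real ^ 'n" where
  "real_vec a = (\<chi> i. real_of_int (a $ i))"

definition sup_norm :: "int ^ 'n::finite \<Rightarrow> real" where
  "sup_norm a = infnorm (real_vec a)"

definition dist_nearest_int :: "real \<Rightarrow> real" where
  "dist_nearest_int x = infdist x \<int>"

definition tends_to_zero :: "(int ^ 'n::finite \<Rightarrow> real) \<Rightarrow> bool" where
  "tends_to_zero \<Psi> \<longleftrightarrow> (\<Psi> \<longlongrightarrow> 0) (filtercomap sup_norm at_top)"

section \<open>The inhomogeneous approximation sets\<close>

text \<open>
  A system of \<open>m\<close> points of \<open>n\<close>-space has type \<open>real ^ 'n ^ 'm\<close>, with \<open>n = CARD('n)\<close> and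
  \<open>m = CARD('m)\<close>; the point \<open>\<^bold>x\<^sub>j\<close> is \<open>X $ j\<close>. The norm of this type is the Euclidean norm
  of all \<open>n * m\<close> coordinates and its Lebesgue measure is \<open>n * m\<close>-dimensional.
\<close>

definition half_open_cube :: "(real ^ 'n ^ 'm) set" where
  "half_open_cube = {X. \<forall>j i. 0 \<le> X $ j $ i \<and> X $ j $ i < 1}"

definition well_approximable ::
    "real ^ 'm \<Rightarrow> (int ^ 'n \<Rightarrow> real) \<Rightarrow> (real ^ 'n::finite ^ 'm::finite) set" where
  "well_approximable b \<Psi> = {X \<in> half_open_cube.
     infinite {a. \<forall>j. dist_nearest_int (real_vec a \<bullet> X $ j - b $ j) < \<Psi> a}}"

section \<open>Dimension functions and Hausdorff measures\<close>

text \<open>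
  Functions on the non-negative half-line are represented by functions on \<open>real\<close> whose values
  at negative arguments are irrelevant.
\<close>

definition dimension_function :: "(real \<Rightarrow> real) \<Rightarrow> bool" where
  "dimension_function f \<longleftrightarrow>
     (\<forall>r\<ge>0. 0 \<le> f r) \<and> continuous_on {0..} f \<and> mono_on {0..} f \<and> (f \<longlongrightarrow> 0) (at_right 0)"

text \<open>
  A countable (finite or infinite) collection of balls is given by centres \<open>c i\<close> and radii \<open>r i\<close>
  for \<open>i\<close> in a set \<open>I\<close> of natural numbers. Using closed balls instead of open ones would not
  change \<open>hausdorff_measure f\<close> for a dimension function \<open>f\<close>, by continuity of \<open>f\<close>.
\<close>

definition hausdorff_premeasure ::
    "(real \<Rightarrow> real) \<Rightarrow> real \<Rightarrow> 'a::euclidean_space set \<Rightarrow> ennreal" where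
  "hausdorff_premeasure f \<rho> F =
     Inf {(\<Sum>\<^sub>\<infinity>i\<in>I. ennreal (f (r i))) | (I :: nat set) (c :: nat \<Rightarrow> 'a) r.
            (\<forall>i\<in>I. 0 < r i \<and> r i \<le> \<rho>) \<and> F \<subseteq> (\<Union>i\<in>I. ball (c i) (r i))}"

definition hausdorff_measure ::
    "(real \<Rightarrow> real) \<Rightarrow> 'a::euclidean_space set \<Rightarrow> ennreal" where
  "hausdorff_measure f F = (SUP \<rho>\<in>{0<..}. hausdorff_premeasure f \<rho> F)"

text \<open>
  The function \<open>g\<close> with \<open>g r = r powr - ((n - 1) * m) * f r\<close> for \<open>r > 0\<close> and \<open>g 0 = 0\<close>; here \<open>n \<ge> 1\<close>, so
  the subtraction on \<open>nat\<close> is exact.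
\<close>

definition reduced_function :: "nat \<Rightarrow> nat \<Rightarrow> (real \<Rightarrow> real) \<Rightarrow> real \<Rightarrow> real" where
  "reduced_function n m f r = (if r > 0 then f r / r ^ ((n - 1) * m) else 0)"

end

theory Submission
  imports Defs
begin

text \<open>
  Write \<open>n\<close>, \<open>m\<close> for the dimensions, \<open>k = n * m\<close>, \<open>l = (n - 1) * m\<close>, so that
  \<open>f r = r ^ l * g r\<close>. Everything depends on the size of \<open>f r / r ^ k\<close> near \<open>0\<close>.

  If it is bounded, then \<open>g (\<Psi> a / |a|) * |a| ^ m\<close> is at most a constant times \<open>\<Psi> a ^ m\<close>, so Schmidt's
  theorem applies to \<open>\<Psi>\<close> itself, and \<open>W(\<Psi>)\<close> misses only a Lebesgue null set of the cube. Null sets are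
  also null for the Hausdorff measure of such an \<open>f\<close> (\<open>hausdorff_premeasure_negligible\<close>), which gives
  equality of the two measures.

  If it is unbounded, monotonicity makes it decrease in \<open>r\<close> and tend to infinity at \<open>0\<close>. Then it
  has to be shown that \<open>W(\<Psi>)\<close> has infinite measure. This is done by slicing. For some coordinate
  \<open>i0\<close> the series still diverges over the \<open>a\<close> with \<open>|a $ i0| = |a|\<close>. Let only column \<open>i0\<close> of \<open>X\<close> vary,
  by a vector \<open>y\<close> in \<open>m\<close>-space. On such a slice, each \<open>a\<close> restricts \<open>y\<close> to a union of cubes of half
  side \<open>\<Psi> a / |a|\<close>. Schmidt's theorem, applied to the function
  \<open>|a| * g (\<Psi> a / |a|) powr (1 / m)\<close>, says that on almost every slice almost every point lies in
  infinitely many of the cubes enlarged to half side \<open>g (\<Psi> a / |a|) powr (1 / m)\<close>. The mass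
  transference principle in \<open>m\<close>-space (\<open>hausdorff_measure_shrunk_limsup\<close>) turns this into: the points
  that lie in infinitely many of the original cubes have infinite Hausdorff \<open>g\<close>-measure. Integrating
  over the slices (\<open>hausdorff_measure_infinite_if_slices\<close>) gives infinite Hausdorff \<open>f\<close>-measure.

  Schmidt's theorem needs a function that tends to zero, and the one above need not. The
  terms of the divergent series are therefore first decreased to terms tending to zero whose sum still
  diverges (\<open>divergent_series_thinning\<close>), and by continuity of \<open>g\<close> the new terms come from smaller
  radii.

  The mass transference principle is proved by a direct construction. Given a cover of the limsup
  set by small balls with finite \<open>g\<close>-sum, nested balls of the family are chosen such that the cover
  balls meeting each of them are smaller than it and have small total \<open>g\<close>-weight compared with it. The
  common point of the nested balls lies in the limsup set and in no ball of the cover.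
\<close>

section \<open>Sums of non-negative terms\<close>

lemma infsum_ennreal_eq_SUP:
  fixes f :: "'a \<Rightarrow> ennreal"
  shows "infsum f A = (SUP F\<in>{F. finite F \<and> F \<subseteq> A}. sum f F)"
  by (rule nonneg_infsum_complete) simp

lemma infsum_ennreal_nat_eq_suminf:
  fixes f :: "nat \<Rightarrow> ennreal"
  shows "infsum f I = (\<Sum>i. f i * indicator I i)"
proof -
  have "infsum f I = infsum (\<lambda>i. f i * indicator I i) UNIV"
    by (rule infsum_cong_neutral) auto
  also have "\<dots> = (\<Sum>i. f i * indicator I i)"
    by (intro sums_unique has_sum_imp_sums has_sum_infsum nonneg_summable_on_complete) simp
  finally show ?thesis .
qed

lemma infsum_ennreal_eq_top_iff:
  fixes t :: "'a \<Rightarrow> real"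
  assumes "\<And>x. x \<in> A \<Longrightarrow> 0 \<le> t x"
  shows "infsum (\<lambda>x. ennreal (t x)) A = \<infinity> \<longleftrightarrow> (\<forall>M. \<exists>F. finite F \<and> F \<subseteq> A \<and> M \<le> sum t F)"
proof -
  have s: "sum (\<lambda>x. ennreal (t x)) F = ennreal (sum t F)" if "F \<subseteq> A" for F
    using assms that by (intro sum_ennreal) auto
  show ?thesis
  proof
    assume top: "infsum (\<lambda>x. ennreal (t x)) A = \<infinity>"
    show "\<forall>M. \<exists>F. finite F \<and> F \<subseteq> A \<and> M \<le> sum t F"
    proof
      fix M
      have "ennreal M < (SUP F\<in>{F. finite F \<and> F \<subseteq> A}. sum (\<lambda>x. ennreal (t x)) F)"
        using top by (simp add: infsum_ennreal_eq_SUP[symmetric])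
      then obtain F where "finite F" "F \<subseteq> A" "ennreal M < ennreal (sum t F)"
        by (auto simp: less_SUP_iff s)
      then show "\<exists>F. finite F \<and> F \<subseteq> A \<and> M \<le> sum t F"
        by (metis ennreal_leI leD nle_le)
    qed
  next
    assume *: "\<forall>M. \<exists>F. finite F \<and> F \<subseteq> A \<and> M \<le> sum t F"
    have "\<exists>F\<in>{F. finite F \<and> F \<subseteq> A}. of_nat n \<le> sum (\<lambda>x. ennreal (t x)) F" for n
    proof -
      obtain F where "finite F" "F \<subseteq> A" "real n \<le> sum t F"
        using * by blast
      then show ?thesis
        using s by (metis (mono_tags, lifting) ennreal_leI ennreal_of_nat_eq_real_of_nat mem_Collect_eq)
    qed
    then show "infsum (\<lambda>x. ennreal (t x)) A = \<infinity>"
      by (simp add: infsum_ennreal_eq_SUP ennreal_SUP_eq_top)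
  qed
qed

text \<open>
  In an enumeration of the indices, let \<open>S n\<close> be \<open>1\<close> plus the sum of the first \<open>n\<close> terms, each truncated
  at \<open>1\<close>. The increments of \<open>sqrt (S n)\<close> telescope, hence still have a divergent sum, but they are the
  truncated terms divided by \<open>sqrt (S (n + 1)) + sqrt (S n)\<close>, hence are smaller and tend to zero.
\<close>

lemma divergent_series_thinning:
  fixes t :: "'a::countable \<Rightarrow> real"
  assumes nn: "\<And>x. 0 \<le> t x" and div: "\<And>M. \<exists>F. finite F \<and> M \<le> sum t F"
  obtains s where "\<And>x. 0 \<le> s x" "\<And>x. s x \<le> t x" "\<And>e. 0 < e \<Longrightarrow> finite {x. e \<le> s x}"
    "\<And>M. \<exists>F. finite F \<and> M \<le> sum s F"
proof -
  define u where "u n = (if n \<in> range (to_nat :: 'a \<Rightarrow> nat) then min 1 (t (from_nat n)) else 0)" for n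
  define S where "S n = 1 + (\<Sum>k<n. u k)" for n
  define v where "v n = sqrt (S (Suc n)) - sqrt (S n)" for n
  have u: "0 \<le> u n" "u n \<le> 1" for n using nn by (auto simp: u_def)
  have S1: "1 \<le> S n" for n using u by (simp add: S_def sum_nonneg)
  have SSuc: "S (Suc n) = S n + u n" for n by (simp add: S_def)
  have vmul: "v n * (sqrt (S (Suc n)) + sqrt (S n)) = u n" for n
  proof -
    have "v n * (sqrt (S (Suc n)) + sqrt (S n)) = (sqrt (S (Suc n)))\<^sup>2 - (sqrt (S n))\<^sup>2"
      unfolding v_def by (simp add: power2_eq_square algebra_simps)
    also have "\<dots> = u n" using S1[of n] S1[of "Suc n"] SSuc by simp
    finally show ?thesis .
  qed
  have v0: "0 \<le> v n" for n using SSuc u by (simp add: v_def)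
  have sq1: "1 \<le> sqrt (S n)" for n using S1 by simp
  have vu: "v n * sqrt (S n) \<le> u n" for n
  proof -
    have "v n * sqrt (S n) \<le> v n * (sqrt (S (Suc n)) + sqrt (S n))"
      using v0 sq1[of "Suc n"] by (intro mult_left_mono) auto
    then show ?thesis by (simp add: vmul)
  qed
  have vleu: "v n \<le> u n" for n
    using vu[of n] mult_left_mono[OF sq1[of n] v0[of n]] by simp
  \<comment> \<open>Truncation keeps the divergence: either infinitely many terms become \<open>1\<close>, or only finitely
    many terms change.\<close>
  have Sdiv: "\<exists>n. M \<le> S n" for M
  proof (cases "finite {x. 1 \<le> t x}")
    case True
    let ?B = "{x. 1 \<le> t x}"
    obtain F where F: "finite F" "M + sum t ?B \<le> sum t F" using div by blast
    obtain n where n: "to_nat ` F \<subseteq> {..<n}"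
      using F(1) by (metis finite_imageI finite_nat_iff_bounded)
    have "sum t F = sum t (F \<inter> ?B) + sum t (F - ?B)"
      using F(1) by (metis sum.Int_Diff)
    moreover have "sum t (F \<inter> ?B) \<le> sum t ?B"
      using True nn by (intro sum_mono2) auto
    ultimately have "M \<le> sum t (F - ?B)" using F(2) by simp
    also have "\<dots> = (\<Sum>x\<in>F - ?B. u (to_nat x))"
      by (intro sum.cong) (auto simp: u_def)
    also have "\<dots> = sum u (to_nat ` (F - ?B))"
      by (subst sum.reindex) (auto intro: inj_on_subset[OF inj_to_nat])
    also have "\<dots> \<le> sum u {..<n}"
      using n u by (intro sum_mono2) auto
    finally show ?thesis by (intro exI[of _ n]) (simp add: S_def)
  next
    case False
    obtain F where F: "F \<subseteq> {x. 1 \<le> t x}" "card F = nat \<lceil>M\<rceil>" "finite F"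
      using infinite_arbitrarily_large[OF False] by blast
    obtain n where n: "to_nat ` F \<subseteq> {..<n}"
      using F(3) by (metis finite_imageI finite_nat_iff_bounded)
    have "M \<le> (\<Sum>x\<in>F. 1)" using F(2) by (simp) linarith
    also have "\<dots> = (\<Sum>x\<in>F. u (to_nat x))"
      using F(1) by (intro sum.cong) (auto simp: u_def)
    also have "\<dots> = sum u (to_nat ` F)"
      by (subst sum.reindex) (auto intro: inj_on_subset[OF inj_to_nat])
    also have "\<dots> \<le> sum u {..<n}"
      using n u by (intro sum_mono2) auto
    finally show ?thesis by (intro exI[of _ n]) (simp add: S_def)
  qed
  have Smono: "S n \<le> S m" if "n \<le> m" for n m
    using that u by (auto simp: S_def intro!: sum_mono2)
  show thesis
  proof
    show "0 \<le> v (to_nat x)" for x :: 'a by (rule v0)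
    show "v (to_nat x) \<le> t x" for x :: 'a
      using vleu[of "to_nat x"] by (auto simp: u_def)
    show "finite {x :: 'a. e \<le> v (to_nat x)}" if e: "0 < e" for e
    proof -
      obtain n where n: "(1 / e + 1)\<^sup>2 \<le> S n" using Sdiv by blast
      have "v k < e" if "n \<le> k" for k
      proof (rule ccontr)
        assume ve: "\<not> v k < e"
        have "1 / e + 1 \<le> sqrt (S k)"
          using n Smono[OF that] by (intro real_le_rsqrt) auto
        then have "e * (1 / e + 1) \<le> v k * sqrt (S k)"
          using ve e by (intro mult_mono) auto
        moreover have "e * (1 / e + 1) = 1 + e" using e by (simp add: field_simps)
        ultimately show False using vu[of k] u[of k] e by linarith
      qed
      then have "to_nat ` {x :: 'a. e \<le> v (to_nat x)} \<subseteq> {..<n}"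
        by (force simp: not_less[symmetric])
      then show ?thesis
        by (meson finite_imageD finite_lessThan finite_subset inj_on_subset inj_to_nat subset_UNIV)
    qed
    show "\<exists>F :: 'a set. finite F \<and> M \<le> (\<Sum>x\<in>F. v (to_nat x))" for M
    proof -
      obtain n where n: "(\<bar>M\<bar> + 1)\<^sup>2 \<le> S n" using Sdiv by blast
      have "M \<le> sqrt (S n) - sqrt (S 0)"
        using real_le_rsqrt[OF n] by (simp add: S_def)
      also have "\<dots> = sum v {..<n}"
        unfolding v_def by (rule sum_lessThan_telescope[of "\<lambda>n. sqrt (S n)", symmetric])
      also have "\<dots> = sum v ({..<n} \<inter> range (to_nat :: 'a \<Rightarrow> nat))"
      proof (intro sum.mono_neutral_right ballI)
        fix k assume "k \<in> {..<n} - {..<n} \<inter> range (to_nat :: 'a \<Rightarrow> nat)"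
        then have "u k = 0" by (simp add: u_def)
        then show "v k = 0" using vleu[of k] v0[of k] by simp
      qed auto
      also have "\<dots> = sum v (to_nat ` ((to_nat :: 'a \<Rightarrow> nat) -` {..<n}))"
        by (intro sum.cong) auto
      also have "\<dots> = (\<Sum>x\<in>(to_nat :: 'a \<Rightarrow> nat) -` {..<n}. v (to_nat x))"
        by (subst sum.reindex) (auto intro: inj_on_subset[OF inj_to_nat])
      finally show ?thesis
        by (intro exI[of _ "(to_nat :: 'a \<Rightarrow> nat) -` {..<n}"]) (simp add: finite_vimageI)
    qed
  qed
qed

section \<open>Hausdorff measures\<close>

lemma hausdorff_premeasure_le_suminf:
  assumes "\<And>i. i \<in> I \<Longrightarrow> 0 < r i \<and> r i \<le> \<rho>" "F \<subseteq> (\<Union>i\<in>I. ball (c i) (r i))"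
  shows "hausdorff_premeasure f \<rho> F \<le> (\<Sum>i. ennreal (f (r i)) * indicator I i)"
  unfolding hausdorff_premeasure_def infsum_ennreal_nat_eq_suminf[symmetric]
  using assms by (intro Inf_lower) blast

lemma hausdorff_premeasure_lessE:
  assumes "hausdorff_premeasure f \<rho> F < x"
  obtains I c r where "\<And>i. i \<in> I \<Longrightarrow> 0 < r i \<and> r i \<le> \<rho>" "F \<subseteq> (\<Union>i\<in>I. ball (c i) (r i))"
    "(\<Sum>i. ennreal (f (r i)) * indicator I i) < x"
  using assms unfolding hausdorff_premeasure_def Inf_less_iff
  by (auto simp: infsum_ennreal_nat_eq_suminf)

lemma hausdorff_premeasure_le_countable:
  fixes c :: "'i \<Rightarrow> 'a::euclidean_space"
  assumes C: "countable C" and "\<And>i. i \<in> C \<Longrightarrow> 0 < r i \<and> r i \<le> \<rho>"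
    and "F \<subseteq> (\<Union>i\<in>C. ball (c i) (r i))"
    and bnd: "\<And>K. finite K \<Longrightarrow> K \<subseteq> C \<Longrightarrow> (\<Sum>i\<in>K. ennreal (f (r i))) \<le> x"
  shows "hausdorff_premeasure f \<rho> F \<le> x"
proof -
  let ?I = "to_nat_on C ` C" and ?n = "from_nat_into C"
  have inj: "inj_on (to_nat_on C) C" using C by (rule inj_on_to_nat_on)
  have "hausdorff_premeasure f \<rho> F \<le> (\<Sum>\<^sub>\<infinity>j\<in>?I. ennreal (f (r (?n j))))"
    unfolding infsum_ennreal_nat_eq_suminf using assms(2,3) C
    by (intro hausdorff_premeasure_le_suminf[where c = "c \<circ> ?n"]) auto
  also have "\<dots> = (\<Sum>\<^sub>\<infinity>i\<in>C. ennreal (f (r i)))"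
    using C inj by (subst infsum_reindex) (auto intro!: infsum_cong simp: comp_def)
  also have "\<dots> \<le> x"
    unfolding infsum_ennreal_eq_SUP using bnd by (intro SUP_least) auto
  finally show ?thesis .
qed

lemma hausdorff_premeasure_antimono:
  assumes "\<rho> \<le> \<sigma>" shows "hausdorff_premeasure f \<sigma> F \<le> hausdorff_premeasure f \<rho> F"
  unfolding hausdorff_premeasure_def
proof (rule Inf_superset_mono, clarify)
  fix I :: "nat set" and c r
  assume "\<forall>i\<in>I. 0 < r i \<and> r i \<le> \<rho>" "F \<subseteq> (\<Union>i\<in>I. ball (c i) (r i))"
  with assms show "\<exists>(I' :: nat set) c' r'. (\<Sum>\<^sub>\<infinity>i\<in>I. ennreal (f (r i))) = (\<Sum>\<^sub>\<infinity>i\<in>I'. ennreal (f (r' i))) \<and>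
      (\<forall>i\<in>I'. 0 < r' i \<and> r' i \<le> \<sigma>) \<and> F \<subseteq> (\<Union>i\<in>I'. ball (c' i) (r' i))"
    by (intro exI[of _ I] exI[of _ c] exI[of _ r]) auto
qed

lemma hausdorff_premeasure_mono:
  assumes "F \<subseteq> F'" shows "hausdorff_premeasure f \<rho> F \<le> hausdorff_premeasure f \<rho> F'"
  unfolding hausdorff_premeasure_def
proof (rule Inf_superset_mono, clarify)
  fix I :: "nat set" and c r
  assume "\<forall>i\<in>I. 0 < r i \<and> r i \<le> \<rho>" "F' \<subseteq> (\<Union>i\<in>I. ball (c i) (r i))"
  with assms show "\<exists>(I' :: nat set) c' r'. (\<Sum>\<^sub>\<infinity>i\<in>I. ennreal (f (r i))) = (\<Sum>\<^sub>\<infinity>i\<in>I'. ennreal (f (r' i))) \<and>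
      (\<forall>i\<in>I'. 0 < r' i \<and> r' i \<le> \<rho>) \<and> F \<subseteq> (\<Union>i\<in>I'. ball (c' i) (r' i))"
    by (intro exI[of _ I] exI[of _ c] exI[of _ r]) auto
qed

lemma hausdorff_measure_mono:
  assumes "F \<subseteq> F'" shows "hausdorff_measure f F \<le> hausdorff_measure f F'"
  unfolding hausdorff_measure_def
  by (intro SUP_mono') (simp add: assms hausdorff_premeasure_mono)

lemma hausdorff_premeasure_le_measure:
  "0 < \<rho> \<Longrightarrow> hausdorff_premeasure f \<rho> F \<le> hausdorff_measure f F"
  unfolding hausdorff_measure_def by (rule SUP_upper) simp

lemma hausdorff_premeasure_Un_null:
  assumes Z: "hausdorff_premeasure f \<rho> Z = 0"
  shows "hausdorff_premeasure f \<rho> (F \<union> Z) \<le> hausdorff_premeasure f \<rho> F"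
proof (rule ennreal_le_epsilon)
  fix e :: real
  assume fin: "hausdorff_premeasure f \<rho> F < top" and e: "0 < e"
  have "hausdorff_premeasure f \<rho> F < hausdorff_premeasure f \<rho> F + ennreal (e / 2)"
    using fin e by (simp add: ennreal_add_left_cancel_less[where b=0, simplified])
  then obtain I c r where 1: "\<And>i. i \<in> I \<Longrightarrow> 0 < r i \<and> r i \<le> \<rho>" "F \<subseteq> (\<Union>i\<in>I. ball (c i) (r i))"
    "(\<Sum>i. ennreal (f (r i)) * indicator I i) < hausdorff_premeasure f \<rho> F + ennreal (e / 2)"
    by (rule hausdorff_premeasure_lessE) blast
  have "hausdorff_premeasure f \<rho> Z < ennreal (e / 2)" using Z e by simp
  then obtain I' c' r' where 2: "\<And>i. i \<in> I' \<Longrightarrow> 0 < r' i \<and> r' i \<le> \<rho>" "Z \<subseteq> (\<Union>i\<in>I'. ball (c' i) (r' i))"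
    "(\<Sum>i. ennreal (f (r' i)) * indicator I' i) < ennreal (e / 2)"
    by (rule hausdorff_premeasure_lessE) blast
  let ?r = "case_sum r r'"
  have "hausdorff_premeasure f \<rho> (F \<union> Z)
     \<le> (\<Sum>i. ennreal (f (r i)) * indicator I i) + (\<Sum>i. ennreal (f (r' i)) * indicator I' i)"
  proof (rule hausdorff_premeasure_le_countable[where C = "I <+> I'" and c = "case_sum c c'" and r = ?r])
    show "countable (I <+> I')" by simp
    show "0 < ?r i \<and> ?r i \<le> \<rho>" if "i \<in> I <+> I'" for i
      using that 1(1) 2(1) by auto
    show "F \<union> Z \<subseteq> (\<Union>i\<in>I <+> I'. ball (case_sum c c' i) (?r i))"
      using 1(2) 2(2) by (fastforce simp: Plus_def)
    fix K assume K: "finite K" "K \<subseteq> I <+> I'"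
    let ?K = "Inl -` K" and ?K' = "Inr -` K"
    have fin: "finite ?K" "finite ?K'" using K(1) by (auto intro!: finite_vimageI)
    have "K = ?K <+> ?K'" 
      unfolding Plus_def by (auto simp: image_iff) (metis sum.exhaust)
    then have "(\<Sum>i\<in>K. ennreal (f (?r i))) = (\<Sum>i\<in>?K <+> ?K'. ennreal (f (?r i)))" by simp
    also have "\<dots> = (\<Sum>i\<in>?K. ennreal (f (r i))) + (\<Sum>i\<in>?K'. ennreal (f (r' i)))"
      using fin by (simp add: sum.Plus)
    also have "(\<Sum>i\<in>?K. ennreal (f (r i))) = (\<Sum>i\<in>?K. ennreal (f (r i)) * indicator I i)"
      using K(2) by (intro sum.cong) auto
    also have "(\<Sum>i\<in>?K'. ennreal (f (r' i))) = (\<Sum>i\<in>?K'. ennreal (f (r' i)) * indicator I' i)"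
      using K(2) by (intro sum.cong) auto
    also have "(\<Sum>i\<in>?K. ennreal (f (r i)) * indicator I i) + (\<Sum>i\<in>?K'. ennreal (f (r' i)) * indicator I' i)
        \<le> (\<Sum>i. ennreal (f (r i)) * indicator I i) + (\<Sum>i. ennreal (f (r' i)) * indicator I' i)"
      using fin by (intro add_mono sum_le_suminf) auto
    finally show "(\<Sum>i\<in>K. ennreal (f (?r i))) \<le>
        (\<Sum>i. ennreal (f (r i)) * indicator I i) + (\<Sum>i. ennreal (f (r' i)) * indicator I' i)" .
  qed
  also have "\<dots> \<le> hausdorff_premeasure f \<rho> F + ennreal (e / 2) + ennreal (e / 2)"
    using 1(3) 2(3) by (intro add_mono) auto
  also have "\<dots> = hausdorff_premeasure f \<rho> F + ennreal e"
    using e by (simp add: add.assoc flip: ennreal_plus)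
  finally show "hausdorff_premeasure f \<rho> (F \<union> Z) \<le> hausdorff_premeasure f \<rho> F + ennreal e" .
qed

lemma disjoint_cballs_volume_eq:
  fixes a :: "'i \<Rightarrow> 'a::euclidean_space"
  assumes "finite K" "\<And>i. i \<in> K \<Longrightarrow> 0 \<le> r i"
    and "pairwise (\<lambda>i j. disjnt (cball (a i) (r i)) (cball (a j) (r j))) K"
  shows "measure lebesgue (\<Union>i\<in>K. cball (a i) (r i)) = unit_ball_vol DIM('a) * (\<Sum>i\<in>K. r i ^ DIM('a))"
proof -
  have "measure lebesgue (\<Union>i\<in>K. cball (a i) (r i)) = (\<Sum>i\<in>K. measure lebesgue (cball (a i) (r i)))"
    using assms(1,3)
    by (intro measure_negligible_finite_Union_image) (auto simp: pairwise_def disjnt_def)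
  also have "\<dots> = (\<Sum>i\<in>K. unit_ball_vol DIM('a) * r i ^ DIM('a))"
    using assms(2) by (intro sum.cong) (auto simp: content_cball measure_completion)
  finally show ?thesis by (simp add: sum_distrib_left)
qed

lemma disjoint_cballs_volume_le:
  fixes a :: "'i \<Rightarrow> 'a::euclidean_space"
  assumes "finite K" "\<And>i. i \<in> K \<Longrightarrow> 0 \<le> r i"
    and "pairwise (\<lambda>i j. disjnt (cball (a i) (r i)) (cball (a j) (r j))) K"
    and "\<And>i. i \<in> K \<Longrightarrow> cball (a i) (r i) \<subseteq> U" "U \<in> lmeasurable"
  shows "unit_ball_vol DIM('a) * (\<Sum>i\<in>K. r i ^ DIM('a)) \<le> measure lebesgue U"
proof -
  have "unit_ball_vol DIM('a) * (\<Sum>i\<in>K. r i ^ DIM('a)) = measure lebesgue (\<Union>i\<in>K. cball (a i) (r i))"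
    using assms by (intro disjoint_cballs_volume_eq[symmetric])
  also have "\<dots> \<le> measure lebesgue U"
  proof (rule measure_mono_fmeasurable)
    show "(\<Union>i\<in>K. cball (a i) (r i)) \<subseteq> U" using assms(4) by blast
    show "(\<Union>i\<in>K. cball (a i) (r i)) \<in> sets lebesgue" using assms(1) by (intro sets.finite_UN) auto
  qed (rule assms(5))
  finally show ?thesis .
qed

text \<open>
  Enclose the null set in an open set of small volume and centre at each of its points a ball inside
  the open set. Vitali's covering lemma selects disjoint ones among these balls whose fivefold
  enlargements still cover. Their volumes, and thus the sum of \<open>x ^ DIM('a)\<close> over their radii, are
  bounded by the volume of the open set.
\<close>

lemma hausdorff_premeasure_negligible:
  fixes N :: "'a::euclidean_space set"
  assumes N: "negligible N" and \<rho>: "0 < \<rho>" and "0 < r0"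
    and f: "\<And>x. 0 < x \<Longrightarrow> x \<le> r0 \<Longrightarrow> 0 \<le> f x \<and> f x \<le> K * x ^ DIM('a)"
  shows "hausdorff_premeasure f \<rho> N = 0"
proof -
  define v where "v = unit_ball_vol (real DIM('a))"
  have v: "0 < v" by (simp add: v_def unit_ball_vol_pos)
  have "0 \<le> K * r0 ^ DIM('a)" using f[of r0] \<open>0 < r0\<close> by simp
  then have K: "0 \<le> K" using zero_less_power[OF \<open>0 < r0\<close>] by (metis zero_le_mult_iff not_le)
  have approx: "hausdorff_premeasure f \<rho> N \<le> 0 + ennreal e" if e: "0 < e" for e
  proof -
    define \<delta> where "\<delta> = e * v / ((K + 1) * 6 ^ DIM('a))"
    have \<delta>: "0 < \<delta>" using e v K by (simp add: \<delta>_def)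
    obtain U where U: "open U" "N \<subseteq> U" "(U - N) \<in> lmeasurable" "emeasure lebesgue (U - N) < ennreal \<delta>"
      using sets_lebesgue_outer_open[of N \<delta>] \<delta> N by (metis negligible_imp_sets)
    have "(U - N) \<union> N \<in> lmeasurable" 
      by (rule fmeasurable.Un[OF U(3) negligible_imp_measurable[OF N]])
    moreover have "(U - N) \<union> N = U" using U by auto
    ultimately have Um: "U \<in> lmeasurable" by simp
    have "measure lebesgue U = measure lebesgue (U - N)"
      using N Um by (simp add: measure_Diff_null_set negligible_iff_null_sets fmeasurableD)
    then have mU: "measure lebesgue U < \<delta>"
      using U(3,4) \<delta> by (simp add: emeasure_eq_measure2 ennreal_less_iff)
    \<comment> \<open>The covering balls will be open balls of radius \<open>6 * s x\<close>, as the lemma gives closed ones of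
      radius \<open>5 * s x\<close>.\<close>
    define \<sigma> where "\<sigma> = min \<rho> r0 / 6"
    have \<sigma>: "0 < \<sigma>" using \<rho> \<open>0 < r0\<close> by (simp add: \<sigma>_def)
    have "\<exists>s. 0 < s \<and> s \<le> \<sigma> \<and> cball x s \<subseteq> U" if "x \<in> N" for x
    proof -
      have "x \<in> U" using U(2) that by blast
      then obtain s where "0 < s" "cball x s \<subseteq> U"
        using U(1) open_contains_cball_eq[OF U(1)] by auto
      moreover have "cball x (min s \<sigma>) \<subseteq> cball x s" by (rule subset_cball) simp
      ultimately show ?thesis using \<sigma> by (intro exI[of _ "min s \<sigma>"]) auto
    qed
    then obtain s where s: "\<And>x. x \<in> N \<Longrightarrow> 0 < s x \<and> s x \<le> \<sigma>" "\<And>x. x \<in> N \<Longrightarrow> cball x (s x) \<subseteq> U"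
      by metis
    have "N \<subseteq> (\<Union>x\<in>N. cball x (s x))" using s(1) by force
    then obtain C where C: "countable C" "C \<subseteq> N"
      "pairwise (\<lambda>i j. disjnt (cball i (s i)) (cball j (s j))) C" "N \<subseteq> (\<Union>i\<in>C. cball i (5 * s i))"
      by (rule Vitali_covering_lemma_cballs[OF _ s(1)]) blast
    show ?thesis
    proof (rule hausdorff_premeasure_le_countable[OF C(1), of "\<lambda>x. 6 * s x"])
      show "0 < 6 * s i \<and> 6 * s i \<le> \<rho>" if "i \<in> C" for i
        using s(1)[of i] that C(2) by (auto simp: \<sigma>_def)
      have "cball i (5 * s i) \<subseteq> ball i (6 * s i)" if "i \<in> C" for i
        using s(1)[of i] that C(2) by auto
      then show "N \<subseteq> (\<Union>i\<in>C. ball i (6 * s i))" using C(4) by blast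
      fix L assume L: "finite L" "L \<subseteq> C"
      have LN: "i \<in> N" if "i \<in> L" for i using that L C by auto
      have fs: "0 \<le> f (6 * s i)" "f (6 * s i) \<le> K * (6 * s i) ^ DIM('a)" if "i \<in> L" for i
        using f[of "6 * s i"] s(1)[OF LN[OF that]] by (auto simp: \<sigma>_def)
      have "(\<Sum>i\<in>L. f (6 * s i)) \<le> (\<Sum>i\<in>L. K * (6 * s i) ^ DIM('a))"
        using fs by (intro sum_mono) auto
      also have "\<dots> = K * 6 ^ DIM('a) * (\<Sum>i\<in>L. s i ^ DIM('a))"
        by (simp add: power_mult_distrib sum_distrib_left mult_ac)
      also have "\<dots> = K * 6 ^ DIM('a) / v * (v * (\<Sum>i\<in>L. s i ^ DIM('a)))"
        using v by simp
      also have "\<dots> \<le> K * 6 ^ DIM('a) / v * measure lebesgue U"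
      proof (rule mult_left_mono)
        show "v * (\<Sum>i\<in>L. s i ^ DIM('a)) \<le> measure lebesgue U"
          unfolding v_def
        proof (rule disjoint_cballs_volume_le[OF L(1)])
          show "pairwise (\<lambda>i j. disjnt (cball i (s i)) (cball j (s j))) L"
            using C(3) L(2) by (rule pairwise_subset)
        qed (use s LN Um in \<open>auto intro: less_imp_le\<close>)
      qed (use K v in auto)
      also have "\<dots> \<le> K * 6 ^ DIM('a) / v * \<delta>"
        using mU K v by (intro mult_left_mono) auto
      also have "\<dots> = e * (K / (K + 1))"
      proof -
        have "K * p / v * (e * v / (q * p)) = e * (K / q)" if "0 < p" "0 < q" for p q :: real
          using v that by (simp add: divide_simps)
        from this[of "6 ^ DIM('a)" "K + 1"] show ?thesis using K by (simp add: \<delta>_def)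
      qed
      also have "\<dots> \<le> e * 1"
        using e K by (intro mult_left_mono) auto
      finally have "(\<Sum>i\<in>L. f (6 * s i)) \<le> e" by simp
      then show "(\<Sum>i\<in>L. ennreal (f (6 * s i))) \<le> 0 + ennreal e"
        using fs by (simp add: sum_ennreal ennreal_leI)
    qed
  qed
  have "hausdorff_premeasure f \<rho> N \<le> 0"
    by (rule ennreal_le_epsilon) (rule approx)
  then show ?thesis by simp
qed

section \<open>The mass transference principle for balls\<close>

text \<open>
  Almost every point of \<open>\<Omega>\<close> lies in arbitrarily small large balls, those of radius \<open>R j\<close>. Their volume
  is proportional to \<open>g (r j)\<close>, the \<open>g\<close>-weight of the shrunk balls of radius \<open>r j\<close>, while by
  \<open>g_blowup\<close> the volume of the shrunk balls themselves is negligible in comparison. The aim is to show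
  that the set of points in arbitrarily small shrunk balls is large for the Hausdorff \<open>g\<close>-measure.
\<close>

locale shrunk_balls =
  fixes c :: "'j \<Rightarrow> 'a::euclidean_space" and r R :: "'j \<Rightarrow> real" and g :: "real \<Rightarrow> real"
    and L :: real and \<Omega> :: "'a set"
  assumes r_pos: "\<And>j. 0 < r j" and R_pos: "\<And>j. 0 < R j" and L_pos: "0 < L"
    and R_power: "\<And>j. R j ^ DIM('a) = L * g (r j)"
    and g_mono: "\<And>x y. 0 < x \<Longrightarrow> x \<le> y \<Longrightarrow> g x \<le> g y"
    and g_anti: "\<And>x y. 0 < x \<Longrightarrow> x \<le> y \<Longrightarrow> g y / y ^ DIM('a) \<le> g x / x ^ DIM('a)"
    and g_small: "\<And>e. 0 < e \<Longrightarrow> \<exists>d>0. \<forall>x. 0 < x \<longrightarrow> x < d \<longrightarrow> g x < e"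
    and g_blowup: "\<And>M. \<exists>d>0. \<forall>x. 0 < x \<longrightarrow> x < d \<longrightarrow> M \<le> g x / x ^ DIM('a)"
    and open_\<Omega>: "open \<Omega>"
    and full: "negligible {y \<in> \<Omega>. \<not> (\<forall>e>0. \<exists>j. r j < e \<and> y \<in> cball (c j) (R j))}"
begin


lemma g_pos: "0 < x \<Longrightarrow> 0 < g x"
proof -
  assume x: "0 < x"
  obtain d where d: "0 < d" "\<And>y. 0 < y \<Longrightarrow> y < d \<Longrightarrow> 1 \<le> g y / y ^ DIM('a)"
    using g_blowup[of 1] by metis
  define y where "y = min x (d / 2)"
  have y: "0 < y" "y \<le> x" "y < d" using x d(1) by (auto simp: y_def)
  have "0 < g y / y ^ DIM('a)" using d(2)[OF y(1,3)] by linarith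
  then have "0 < g y" using y(1) by (simp add: zero_less_divide_iff)
  also have "g y \<le> g x" using y by (intro g_mono)
  finally show ?thesis .
qed

lemma R_small:
  assumes "0 < e" shows "\<exists>d>0. \<forall>j. r j < d \<longrightarrow> R j < e"
proof -
  obtain d where d: "0 < d" "\<And>x. 0 < x \<Longrightarrow> x < d \<Longrightarrow> g x < e ^ DIM('a) / L"
    using g_small[of "e ^ DIM('a) / L"] assms L_pos by auto
  have "R j < e" if "r j < d" for j
  proof -
    have "R j ^ DIM('a) < e ^ DIM('a)"
      unfolding R_power using d(2)[OF r_pos that] L_pos by (simp add: pos_less_divide_eq mult.commute)
    then show ?thesis by (rule power_less_imp_less_base) (use assms in simp)
  qed
  then show ?thesis using d(1) by blast
qed

lemma r_much_smaller_than_R: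
  assumes "0 < \<eta>" shows "\<exists>d>0. \<forall>j. r j < d \<longrightarrow> (3 * r j) ^ DIM('a) \<le> \<eta> * R j ^ DIM('a)"
proof -
  obtain d where d: "0 < d" "\<And>x. 0 < x \<Longrightarrow> x < d \<Longrightarrow> 3 ^ DIM('a) / (\<eta> * L) \<le> g x / x ^ DIM('a)"
    using g_blowup[of "3 ^ DIM('a) / (\<eta> * L)"] by metis
  have "(3 * r j) ^ DIM('a) \<le> \<eta> * R j ^ DIM('a)" if "r j < d" for j
  proof -
    have cross: "p * y \<le> x * q" if "p / q \<le> x / y" "0 < q" "0 < y" for p q x y :: real
      using that by (simp add: field_simps)
    have "3 ^ DIM('a) * r j ^ DIM('a) \<le> g (r j) * (\<eta> * L)"
      using d(2)[OF r_pos that] by (rule cross) (use L_pos assms r_pos in auto)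
    then show ?thesis unfolding R_power by (simp only: power_mult_distrib mult_ac)
  qed
  then show ?thesis using d(1) by blast
qed

text \<open>
  Vitali's covering theorem: disjoint large balls of the family fill almost all of \<open>U\<close>, and finitely
  many of them fill half of it.
\<close>

lemma exists_layer:
  assumes U: "open U" "U \<subseteq> \<Omega>" "bounded U" and \<delta>: "0 < \<delta>"
  obtains F where "finite F" "\<And>j. j \<in> F \<Longrightarrow> cball (c j) (R j) \<subseteq> U" "\<And>j. j \<in> F \<Longrightarrow> r j < \<delta>"
    "pairwise (\<lambda>i j. disjnt (cball (c i) (R i)) (cball (c j) (R j))) F"
    "measure lebesgue U / 2 \<le> unit_ball_vol DIM('a) * (\<Sum>j\<in>F. R j ^ DIM('a))"
proof (cases "measure lebesgue U = 0")
  case True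
  show ?thesis by (rule that[of "{}"]) (use True in auto)
next
  case False
  have Um: "U \<in> lmeasurable" using U by (simp add: lmeasurable_open)
  define K where "K = {j. cball (c j) (R j) \<subseteq> U \<and> r j < \<delta>}"
  define S where "S = {y \<in> U. \<forall>e>0. \<exists>j. r j < e \<and> y \<in> cball (c j) (R j)}"
  have S: "negligible (U - S)"
    by (rule negligible_subset[OF full]) (use U(2) in \<open>auto simp: S_def\<close>)
  have "\<exists>i. i \<in> K \<and> x \<in> cball (c i) (R i) \<and> R i < d" if x: "x \<in> S" and d: "0 < d" for x d
  proof -
    obtain \<rho> where \<rho>: "0 < \<rho>" "ball x \<rho> \<subseteq> U"
      using x U(1) by (auto simp: S_def open_contains_ball)
    obtain e where e: "0 < e" "\<And>j. r j < e \<Longrightarrow> R j < min d (\<rho> / 2)"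
      using R_small[of "min d (\<rho> / 2)"] d \<rho>(1) by auto
    obtain j where j: "r j < min e \<delta>" "x \<in> cball (c j) (R j)"
    proof -
      have "0 < min e \<delta>" using e(1) \<delta> by simp
      then show thesis using x that unfolding S_def by blast
    qed
    have Rj: "R j < d" "R j < \<rho> / 2" using e(2)[of j] j by auto
    have "cball (c j) (R j) \<subseteq> ball x \<rho>"
    proof
      fix z assume "z \<in> cball (c j) (R j)"
      then show "z \<in> ball x \<rho>"
        using j(2) Rj dist_triangle[of x z "c j"] by (simp add: dist_commute)
    qed
    then show ?thesis using \<rho> j Rj by (auto simp: K_def)
  qed
  then obtain C where C: "countable C" "C \<subseteq> K"
    "pairwise (\<lambda>i j. disjnt (cball (c i) (R i)) (cball (c j) (R j))) C"
    "negligible (S - (\<Union>i\<in>C. cball (c i) (R i)))"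
    by (rule Vitali_covering_theorem_cballs[OF R_pos]) blast
  let ?B = "\<lambda>i. cball (c i) (R i)"
  have sub: "(\<Union>i\<in>C. ?B i) \<subseteq> U" using C(2) by (auto simp: K_def)
  have Bm: "(\<Union>i\<in>C. ?B i) \<in> lmeasurable"
    using C(1) sub Um by (intro fmeasurableI2[OF Um]) (auto intro!: sets.countable_UN'')
  have rest: "negligible (U - (\<Union>i\<in>C. ?B i))"
    by (rule negligible_subset[OF negligible_Un[OF S C(4)]]) auto
  have eq: "measure lebesgue U = measure lebesgue (\<Union>i\<in>C. ?B i)"
  proof (rule measure_negligible_symdiff[OF Bm])
    have "(\<Union>i\<in>C. ?B i) - U = {}" using sub by blast
    then show "negligible (((\<Union>i\<in>C. ?B i) - U) \<union> (U - (\<Union>i\<in>C. ?B i)))"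
      using rest by (simp only: Un_empty_left)
  qed
  have pos: "0 < measure lebesgue U / 2" using False by (simp add: zero_less_measure_iff)
  have "countable (?B ` C)" using C(1) by simp
  then obtain D where D: "D \<subseteq> ?B ` C" "finite D"
    "measure lebesgue (\<Union>(?B ` C)) - measure lebesgue U / 2 < measure lebesgue (\<Union>D)"
  proof (rule measure_countable_Union_approachable[OF _ pos])
    fix D' assume "D' \<subseteq> ?B ` C" "finite D'"
    then show "measure lebesgue (\<Union>D') \<le> measure lebesgue U"
      using sub by (intro measure_mono_fmeasurable Um) (auto intro!: sets.finite_Union)
  qed auto
  obtain F where F: "F \<subseteq> C" "finite F" "D = ?B ` F"
    using D by (meson finite_subset_image)
  show ?thesis
  proof (rule that[OF F(2)])
    show pw: "pairwise (\<lambda>i j. disjnt (?B i) (?B j)) F"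
      using C(3) F(1) by (rule pairwise_subset)
    show "measure lebesgue U / 2 \<le> unit_ball_vol DIM('a) * (\<Sum>j\<in>F. R j ^ DIM('a))"
      using D(3) eq disjoint_cballs_volume_eq[OF F(2) less_imp_le[OF R_pos] pw] F(3) by simp
  qed (use F C(2) in \<open>auto simp: K_def\<close>)
qed

text \<open>
  The open ball of radius \<open>d\<close> about \<open>x\<close> meets the closed shrunk ball, in a form suited to the triangle
  inequality.
\<close>

definition hit :: "'a \<Rightarrow> real \<Rightarrow> 'j \<Rightarrow> bool" where
  "hit x d j \<longleftrightarrow> dist (c j) x < r j + d"

text \<open>
  If the large balls are not much larger than \<open>d\<close>, they all lie in the ball of radius \<open>4 * d\<close> about \<open>x\<close>,
  and comparing volumes bounds the sum of \<open>R j ^ DIM('a) = L * g (r j)\<close>.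
\<close>

lemma layer_hit_bound_small:
  assumes F: "finite F" "pairwise (\<lambda>i j. disjnt (cball (c i) (R i)) (cball (c j) (R j))) F"
    and F': "\<And>j. j \<in> F \<Longrightarrow> r j \<le> d \<and> R j \<le> 2 * d \<and> hit x d j" and d: "0 < d"
  shows "(\<Sum>j\<in>F. g (r j)) \<le> 4 ^ DIM('a) / L * d ^ DIM('a)"
proof -
  let ?v = "unit_ball_vol DIM('a)"
  have "cball (c j) (R j) \<subseteq> cball x (4 * d)" if "j \<in> F" for j
  proof
    fix z assume "z \<in> cball (c j) (R j)"
    then show "z \<in> cball x (4 * d)"
      using F'[OF that] dist_triangle[of x z "c j"] by (auto simp: hit_def dist_commute)
  qed
  then have "?v * (\<Sum>j\<in>F. R j ^ DIM('a)) \<le> measure lebesgue (cball x (4 * d))"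
    using F R_pos by (intro disjoint_cballs_volume_le) (auto intro: less_imp_le)
  also have "\<dots> = ?v * (4 * d) ^ DIM('a)" using d by (simp add: content_cball measure_completion)
  finally have "(\<Sum>j\<in>F. R j ^ DIM('a)) \<le> (4 * d) ^ DIM('a)"
    using unit_ball_vol_pos[of "real DIM('a)"] by simp
  then have "L * (\<Sum>j\<in>F. g (r j)) \<le> 4 ^ DIM('a) * d ^ DIM('a)"
    by (simp add: R_power sum_distrib_left power_mult_distrib)
  then show ?thesis using L_pos by (simp add: field_simps)
qed

text \<open>
  A large ball of radius more than \<open>2 * d\<close> whose shrunk ball, of radius at most \<open>d\<close>, is hit contains the
  point \<open>x\<close>. By disjointness this happens for at most one member, which contributes at most \<open>g d\<close> by
  monotonicity.
\<close>

lemma layer_hit_bound: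
  assumes F: "finite F" "pairwise (\<lambda>i j. disjnt (cball (c i) (R i)) (cball (c j) (R j))) F"
    and d: "0 < d"
  shows "(\<Sum>j | j \<in> F \<and> r j \<le> d \<and> hit x d j. g (r j)) \<le> 4 ^ DIM('a) / L * d ^ DIM('a) + g d"
proof -
  let ?H = "{j \<in> F. r j \<le> d \<and> hit x d j}"
  let ?A = "{j \<in> ?H. R j \<le> 2 * d}" and ?B = "{j \<in> ?H. \<not> R j \<le> 2 * d}"
  have "(\<Sum>j\<in>?H. g (r j)) = (\<Sum>j\<in>?A. g (r j)) + (\<Sum>j\<in>?B. g (r j))"
    using F(1) by (subst sum.union_disjoint[symmetric]) (auto intro!: sum.cong)
  also have "(\<Sum>j\<in>?A. g (r j)) \<le> 4 ^ DIM('a) / L * d ^ DIM('a)"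
    using F d by (intro layer_hit_bound_small) (auto intro: pairwise_subset)
  also have "(\<Sum>j\<in>?B. g (r j)) \<le> g d"
  proof (cases "?B = {}")
    case True then show ?thesis using g_pos[OF d] by (simp only: True) simp
  next
    case False
    then obtain i where i: "i \<in> ?B" by blast
    have xin: "x \<in> cball (c j) (R j)" if "j \<in> ?B" for j
      using that by (auto simp: hit_def)
    have "j = i" if "j \<in> ?B" for j
    proof (rule ccontr)
      assume "j \<noteq> i"
      then have "disjnt (cball (c j) (R j)) (cball (c i) (R i))"
        using F(2) that i by (auto simp: pairwise_def)
      then show False using xin[OF that] xin[OF i] by (auto simp: disjnt_def)
    qed
    then have "?B = {i}" using i by blast
    then have "(\<Sum>j\<in>?B. g (r j)) = g (r i)" by simp
    then show ?thesis using i g_mono[OF r_pos] by simp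
  qed
  finally show ?thesis by simp
qed

text \<open>
  One layer of disjoint large balls in a ball of radius \<open>\<rho>\<close> has total \<open>g\<close>-weight of order
  \<open>\<rho> ^ DIM('a)\<close>, which is much less than \<open>g \<rho>\<close>. So \<open>N\<close> layers are put into the same ball, each
  outside the threefold enlargements of the shrunk balls of the previous ones. The two conditions on
  powers of radii say that the total weight is of order \<open>N * \<rho> ^ DIM('a)\<close> while the enlarged shrunk
  balls leave half of the volume free for another layer.

  The last condition bounds the weight that a cover ball of radius \<open>d\<close> can spoil. Here the term \<open>g d\<close>
  must not be multiplied by \<open>N\<close>: it is caused by shrunk balls with \<open>r j \<le> d\<close> and \<open>R j > 2 * d\<close>, and
  these occur in just one layer, because each layer is built from large balls smaller than all shrunk
  balls of the earlier layers.
\<close>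

definition layered :: "'a \<Rightarrow> real \<Rightarrow> real \<Rightarrow> nat \<Rightarrow> 'j set \<Rightarrow> bool" where
  "layered z \<rho> \<delta> N F \<longleftrightarrow> finite F \<and>
    (\<forall>j\<in>F. cball (c j) (R j) \<subseteq> ball z \<rho> \<and> r j \<le> R j \<and> r j < \<delta>) \<and>
    pairwise (\<lambda>i j. disjnt (cball (c i) (3 * r i)) (cball (c j) (3 * r j))) F \<and>
    real N * \<rho> ^ DIM('a) \<le> 4 * (\<Sum>j\<in>F. R j ^ DIM('a)) \<and>
    2 * (\<Sum>j\<in>F. (3 * r j) ^ DIM('a)) < \<rho> ^ DIM('a) \<and>
    (\<forall>x d. 0 < d \<longrightarrow>
       (\<Sum>j | j \<in> F \<and> r j \<le> d \<and> hit x d j. g (r j)) \<le> real N * (4 ^ DIM('a) / L * d ^ DIM('a)) + g d)"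

text \<open>
  By induction on the number of layers. The next layer is taken in the part of the ball not covered by
  the threefold enlargements so far, with radii so small that its own enlargements use up only part of
  the remaining slack, and that its large balls are smaller than every earlier shrunk ball.
\<close>

lemma layered_exists:
  assumes z: "ball z \<rho> \<subseteq> \<Omega>" "0 < \<rho>" and \<delta>: "0 < \<delta>"
  shows "\<exists>F. layered z \<rho> \<delta> N F"
proof (induction N)
  case 0
  have "layered z \<rho> \<delta> 0 {}"
    using z(2) g_pos by (simp add: layered_def less_imp_le)
  then show ?case by blast
next
  case (Suc N)
  then obtain F where FF: "layered z \<rho> \<delta> N F" by blast
  have F: "finite F" "\<And>j. j \<in> F \<Longrightarrow> cball (c j) (R j) \<subseteq> ball z \<rho>"
      "\<And>j. j \<in> F \<Longrightarrow> r j \<le> R j" "\<And>j. j \<in> F \<Longrightarrow> r j < \<delta>"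
    and pwF: "pairwise (\<lambda>i j. disjnt (cball (c i) (3 * r i)) (cball (c j) (3 * r j))) F"
    and bigF: "real N * \<rho> ^ DIM('a) \<le> 4 * (\<Sum>j\<in>F. R j ^ DIM('a))"
    and smallF: "2 * (\<Sum>j\<in>F. (3 * r j) ^ DIM('a)) < \<rho> ^ DIM('a)"
    and hitF: "\<And>x d. 0 < d \<Longrightarrow>
       (\<Sum>j | j \<in> F \<and> r j \<le> d \<and> hit x d j. g (r j)) \<le> real N * (4 ^ DIM('a) / L * d ^ DIM('a)) + g d"
    using FF unfolding layered_def by simp_all
  define v where "v = unit_ball_vol (real DIM('a))"
  have v: "0 < v" by (simp add: v_def)
  define P where "P = \<rho> ^ DIM('a)"
  have P: "0 < P" using z(2) by (simp add: P_def)
  define W where "W = (\<Union>j\<in>F. cball (c j) (3 * r j))"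
  define U where "U = ball z \<rho> - W"
  have Wc: "closed W" unfolding W_def using F(1) by (intro closed_UN) auto
  have Wm: "W \<in> lmeasurable" unfolding W_def using F(1) by (intro fmeasurable.finite_UN) auto
  have U: "open U" "U \<subseteq> \<Omega>" "bounded U"
    unfolding U_def using Wc z(1) by (auto intro: bounded_subset[OF bounded_ball])
  have Um: "U \<in> lmeasurable" using U by (simp add: lmeasurable_open)
  have mball: "measure lebesgue (ball z \<rho>) = v * P"
    using z(2) by (simp add: content_ball measure_completion v_def P_def)
  have mW: "measure lebesgue W = v * (\<Sum>j\<in>F. (3 * r j) ^ DIM('a))"
    unfolding W_def v_def using F(1) pwF r_pos by (intro disjoint_cballs_volume_eq) (auto intro: less_imp_le)
  have "measure lebesgue (ball z \<rho>) \<le> measure lebesgue (U \<union> W)"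
    using Um Wm by (intro measure_mono_fmeasurable) (auto simp: U_def)
  also have "\<dots> \<le> measure lebesgue U + measure lebesgue W"
    using Um Wm by (intro measure_Un_le) (auto intro: fmeasurableD)
  finally have "v * P - v * (\<Sum>j\<in>F. (3 * r j) ^ DIM('a)) \<le> measure lebesgue U"
    using mball mW by simp
  moreover have "v * (\<Sum>j\<in>F. (3 * r j) ^ DIM('a)) \<le> v * (P / 2)"
    using smallF v by (intro mult_left_mono) (auto simp: P_def)
  ultimately have mU: "v * P / 2 \<le> measure lebesgue U" by (simp add: field_simps)
  \<comment> \<open>Proportional to the slack in \<open>smallF\<close>: the new layer may have enlarged shrunk balls of at
    most this proportion of its large balls.\<close>
  define \<eta> where "\<eta> = min 1 ((P - 2 * (\<Sum>j\<in>F. (3 * r j) ^ DIM('a))) / (4 * P))"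
  have \<eta>: "0 < \<eta>" "\<eta> \<le> 1" using smallF P by (auto simp: \<eta>_def P_def)
  have \<eta>P: "\<eta> * P \<le> (P - 2 * (\<Sum>j\<in>F. (3 * r j) ^ DIM('a))) / 4"
  proof -
    have "\<eta> \<le> (P - 2 * (\<Sum>j\<in>F. (3 * r j) ^ DIM('a))) / (4 * P)" unfolding \<eta>_def by (rule min.cobounded2)
    then have "\<eta> * P \<le> (P - 2 * (\<Sum>j\<in>F. (3 * r j) ^ DIM('a))) / (4 * P) * P"
      using P by (intro mult_right_mono) auto
    then show ?thesis using P by simp
  qed
  obtain d1 where d1: "0 < d1" "\<And>j. r j < d1 \<Longrightarrow> (3 * r j) ^ DIM('a) \<le> \<eta> * R j ^ DIM('a)"
    using r_much_smaller_than_R[OF \<eta>(1)] by blast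
  \<comment> \<open>Separates the scales of the old and the new balls.\<close>
  define e where "e = Min (insert 1 (r ` F))"
  have e: "0 < e" "\<And>j. j \<in> F \<Longrightarrow> e \<le> r j"
    using F(1) r_pos by (auto simp: e_def)
  obtain d2 where d2: "0 < d2" "\<And>j. r j < d2 \<Longrightarrow> R j < e"
    using R_small[OF e(1)] by blast
  have "0 < min \<delta> (min d1 d2)" using \<delta> d1 d2 by simp
  then obtain F' where F': "finite F'" "\<And>j. j \<in> F' \<Longrightarrow> cball (c j) (R j) \<subseteq> U"
    "\<And>j. j \<in> F' \<Longrightarrow> r j < min \<delta> (min d1 d2)"
    and pwF': "pairwise (\<lambda>i j. disjnt (cball (c i) (R i)) (cball (c j) (R j))) F'"
    and bigF': "measure lebesgue U / 2 \<le> unit_ball_vol DIM('a) * (\<Sum>j\<in>F'. R j ^ DIM('a))"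
    by (rule exists_layer[OF U]) blast
  have r'\<delta>: "r j < \<delta>" and r'1: "(3 * r j) ^ DIM('a) \<le> \<eta> * R j ^ DIM('a)" and r'e: "R j < e"
    if "j \<in> F'" for j
    using F'(3)[OF that] d1 d2 by auto
  have r3: "3 * r j \<le> R j" if "j \<in> F'" for j
  proof (rule ccontr)
    assume "\<not> 3 * r j \<le> R j"
    then have "R j ^ DIM('a) < (3 * r j) ^ DIM('a)"
      using R_pos[of j] by (intro power_strict_mono) auto
    also have "\<dots> \<le> \<eta> * R j ^ DIM('a)" using r'1[OF that] .
    also have "\<dots> \<le> 1 * R j ^ DIM('a)" using \<eta> R_pos[of j] by (intro mult_right_mono) auto
    finally show False by simp
  qed
  have rR': "r j \<le> R j" if "j \<in> F'" for j using r3[OF that] r_pos[of j] by simp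
  have disj: "F \<inter> F' = {}"
    using e(2) F(3) r'e by (meson disjoint_iff less_le_not_le order.trans)
  have subU: "U \<subseteq> ball z \<rho>" by (auto simp: U_def)
  have sub3: "cball (c j) (3 * r j) \<subseteq> cball (c j) (R j)" if "j \<in> F'" for j
    using r3[OF that] by (rule subset_cball)
  have "layered z \<rho> \<delta> (Suc N) (F \<union> F')"
    unfolding layered_def
  proof (intro conjI ballI allI impI)
    show "finite (F \<union> F')" using F(1) F'(1) by simp
    fix j assume "j \<in> F \<union> F'"
    then show "cball (c j) (R j) \<subseteq> ball z \<rho>" "r j \<le> R j" "r j < \<delta>"
      using F(2-4) F'(2) rR' r'\<delta> subU by blast+
  next
    have "disjnt (cball (c i) (3 * r i)) (cball (c j) (3 * r j))" if "i \<in> F" "j \<in> F'" for i j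
    proof -
      have "cball (c i) (3 * r i) \<subseteq> W" using that(1) by (auto simp: W_def)
      moreover have "cball (c j) (3 * r j) \<subseteq> U" using sub3 F'(2) that(2) by blast
      ultimately show ?thesis by (auto simp: disjnt_def U_def)
    qed
    moreover have "pairwise (\<lambda>i j. disjnt (cball (c i) (3 * r i)) (cball (c j) (3 * r j))) F'"
      unfolding pairwise_def
    proof (intro ballI impI)
      fix i j assume ij: "i \<in> F'" "j \<in> F'" "i \<noteq> j"
      then have "disjnt (cball (c i) (R i)) (cball (c j) (R j))" using pwF' by (auto simp: pairwise_def)
      then show "disjnt (cball (c i) (3 * r i)) (cball (c j) (3 * r j))"
        using sub3[OF ij(1)] sub3[OF ij(2)] by (meson disjnt_subset1 disjnt_subset2)
    qed
    ultimately show "pairwise (\<lambda>i j. disjnt (cball (c i) (3 * r i)) (cball (c j) (3 * r j))) (F \<union> F')"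
      using pwF unfolding pairwise_def by (metis Un_iff disjnt_sym)
  next
    have "v * P / 4 \<le> v * (\<Sum>j\<in>F'. R j ^ DIM('a))"
      using bigF'[folded v_def] mU by linarith
    then have "P / 4 \<le> (\<Sum>j\<in>F'. R j ^ DIM('a))"
      using v by (metis mult_le_cancel_left_pos times_divide_eq_right)
    then show "real (Suc N) * \<rho> ^ DIM('a) \<le> 4 * (\<Sum>j\<in>F \<union> F'. R j ^ DIM('a))"
      using bigF F(1) F'(1) disj by (simp add: sum.union_disjoint P_def algebra_simps)
  next
    have "v * (\<Sum>j\<in>F'. R j ^ DIM('a)) \<le> v * P"
      unfolding mball[symmetric] unfolding v_def
    proof (rule disjoint_cballs_volume_le[OF F'(1) _ pwF'])
      show "cball (c j) (R j) \<subseteq> ball z \<rho>" if "j \<in> F'" for j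
        using F'(2)[OF that] subU by (rule order.trans)
    qed (use R_pos in \<open>auto intro: less_imp_le\<close>)
    then have sumR: "(\<Sum>j\<in>F'. R j ^ DIM('a)) \<le> P" using v by simp
    have "(\<Sum>j\<in>F'. (3 * r j) ^ DIM('a)) \<le> (\<Sum>j\<in>F'. \<eta> * R j ^ DIM('a))"
      using r'1 by (intro sum_mono) auto
    also have "\<dots> = \<eta> * (\<Sum>j\<in>F'. R j ^ DIM('a))" by (simp add: sum_distrib_left)
    also have "\<dots> \<le> \<eta> * P" using sumR \<eta> by (intro mult_left_mono) auto
    finally show "2 * (\<Sum>j\<in>F \<union> F'. (3 * r j) ^ DIM('a)) < \<rho> ^ DIM('a)"
      using \<eta>P smallF F(1) F'(1) disj by (simp add: sum.union_disjoint P_def)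
  next
    fix x and d :: real assume d: "0 < d"
    let ?H = "\<lambda>F. {j. j \<in> F \<and> r j \<le> d \<and> hit x d j}"
    let ?p = "4 ^ DIM('a) / L * d ^ DIM('a)"
    have p: "0 \<le> ?p" using L_pos d by simp
    have split: "(\<Sum>j\<in>?H (F \<union> F'). g (r j)) = (\<Sum>j\<in>?H F. g (r j)) + (\<Sum>j\<in>?H F'. g (r j))"
      using F(1) F'(1) disj by (subst sum.union_disjoint[symmetric]) (auto intro!: sum.cong)
    show "(\<Sum>j\<in>?H (F \<union> F'). g (r j)) \<le> real (Suc N) * ?p + g d"
    proof (cases "d < e")
      \<comment> \<open>Too small a ball to be counted against the old layers.\<close>
      case True
      then have empty: "?H F = {}" using e(2) by force
      have "(\<Sum>j\<in>?H (F \<union> F'). g (r j)) = (\<Sum>j\<in>?H F'. g (r j))" unfolding split empty by simp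
      also have "\<dots> \<le> 1 * ?p + g d" using layer_hit_bound[OF F'(1) pwF' d] by simp
      also have "\<dots> \<le> real (Suc N) * ?p + g d"
        using p by (intro add_right_mono mult_right_mono) auto
      finally show ?thesis .
    next
      \<comment> \<open>All new large balls are smaller than \<open>d\<close>, so the new layer contributes no term \<open>g d\<close>.\<close>
      case False
      have "(\<Sum>j\<in>?H F'. g (r j)) \<le> ?p"
      proof (rule layer_hit_bound_small[OF _ _ _ d])
        show "pairwise (\<lambda>i j. disjnt (cball (c i) (R i)) (cball (c j) (R j))) (?H F')"
          by (rule pairwise_subset[OF pwF']) auto
        show "r j \<le> d \<and> R j \<le> 2 * d \<and> hit x d j" if "j \<in> ?H F'" for j
          using that r'e[of j] False d by auto
      qed (use F' in auto)
      moreover have "(\<Sum>j\<in>?H F. g (r j)) \<le> real N * ?p + g d" by (rule hitF[OF d])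
      moreover have "real (Suc N) * ?p = real N * ?p + ?p"
        by (simp only: of_nat_Suc distrib_right mult_1_left add.commute)
      ultimately show ?thesis unfolding split by linarith
    qed
  qed
  then show ?case by blast
qed


text \<open>
  The proportion of its own weight with which a chosen ball may be loaded. With this
  value the load that \<open>N\<close> layers receive through the volume term of \<open>layered\<close> is at most a quarter of
  their total weight.
\<close>

definition \<kappa> :: real where "\<kappa> = 1 / (16 * 4 ^ DIM('a))"

text \<open>
  The total weight of the balls with centres \<open>x i\<close> and radii \<open>d i\<close> that can meet the ball of radius \<open>\<rho>\<close>
  about \<open>z\<close>.
\<close>

definition cover_load :: "nat set \<Rightarrow> (nat \<Rightarrow> 'a) \<Rightarrow> (nat \<Rightarrow> real) \<Rightarrow> 'a \<Rightarrow> real \<Rightarrow> ennreal" where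
  "cover_load I x d z \<rho> = (\<Sum>i. ennreal (g (d i)) * indicator {i\<in>I. dist z (x i) < \<rho> + d i} i)"

lemma \<kappa>: "0 < \<kappa>" "\<kappa> \<le> 1"
proof -
  have "(1::real) \<le> 4 ^ DIM('a)" by (rule one_le_power) simp
  then have "(1::real) \<le> 16 * 4 ^ DIM('a)" by linarith
  then show "0 < \<kappa>" "\<kappa> \<le> 1" by (auto simp: \<kappa>_def)
qed

text \<open>
  The inductive step of the construction of nested balls. Take many layers inside the given ball. A
  member is spoiled if a cover ball at least as large as it hits it, or if smaller cover balls load it
  with more than \<open>\<kappa>\<close> times its weight. The first kind of damage done by one cover ball is bounded by
  \<open>layered\<close>. The second kind happens to at most one member per cover ball, since the threefold
  enlargements of the members are disjoint. By \<open>ratio\<close> and the choice of \<open>\<kappa>\<close>, for large \<open>N\<close> all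
  the damage together is less than the total weight of the members.

  The weight \<open>G\<close> is not tied to \<open>g \<rho>\<close>, so that the same step also starts the construction: then the
  cover has an arbitrary finite weight and the balls of the cover are small enough for \<open>ratio\<close> to hold.
\<close>

lemma exists_lightly_loaded_ball:
  assumes z: "ball z \<rho> \<subseteq> \<Omega>" "0 < \<rho>" and \<delta>: "0 < \<delta>" and G: "0 < G"
    and load: "cover_load I x d z \<rho> \<le> ennreal (\<kappa> * G)"
    and d: "\<And>i. i \<in> I \<Longrightarrow> 0 < d i"
    and ratio: "\<And>i. i \<in> I \<Longrightarrow> dist z (x i) < \<rho> + d i \<Longrightarrow> G / \<rho> ^ DIM('a) \<le> g (d i) / d i ^ DIM('a)"
  shows "\<exists>j. cball (c j) (r j) \<subseteq> ball z \<rho> \<and> r j < \<delta> \<and>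
    (\<forall>i\<in>I. hit (x i) (d i) j \<longrightarrow> d i < r j) \<and>
    cover_load I x d (c j) (r j) \<le> ennreal (\<kappa> * g (r j))"
proof -
  define P where "P = \<rho> ^ DIM('a)"
  have P: "0 < P" using z(2) by (simp add: P_def)
  define p where "p = 4 ^ DIM('a) / L"
  have p: "0 < p" using L_pos by (simp add: p_def)
  have \<kappa>p: "\<kappa> * p = 1 / (16 * L)" by (simp add: \<kappa>_def p_def)
  obtain N :: nat where "16 * L * G / P < real N" using reals_Archimedean2 by blast
  then have N: "16 * (L * G) < real N * P" using P by (simp add: field_simps)
  obtain F where FF: "layered z \<rho> \<delta> N F" using layered_exists[OF z \<delta>] by blast
  have F: "finite F" "\<And>j. j \<in> F \<Longrightarrow> cball (c j) (R j) \<subseteq> ball z \<rho>"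
      "\<And>j. j \<in> F \<Longrightarrow> r j \<le> R j" "\<And>j. j \<in> F \<Longrightarrow> r j < \<delta>"
    and pwF: "pairwise (\<lambda>i j. disjnt (cball (c i) (3 * r i)) (cball (c j) (3 * r j))) F"
    and bigF: "real N * P \<le> 4 * (\<Sum>j\<in>F. R j ^ DIM('a))"
    and hitF: "\<And>x d. 0 < d \<Longrightarrow>
       (\<Sum>j | j \<in> F \<and> r j \<le> d \<and> hit x d j. g (r j)) \<le> real N * (p * d ^ DIM('a)) + g d"
    using FF unfolding layered_def P_def p_def by simp_all
  have sub: "cball (c j) (r j) \<subseteq> ball z \<rho>" if "j \<in> F" for j
    using F(2,3)[OF that] subset_cball by blast
  have inside: "dist z (x i) < \<rho> + d i" if "j \<in> F" "hit (x i) (d i) j" for i j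
  proof -
    have "dist z (c j) + r j < \<rho>" using sub[OF that(1)] r_pos[of j] by (simp add: cball_subset_ball_iff dist_commute)
    then show ?thesis using that(2) dist_triangle[of z "x i" "c j"] by (simp add: hit_def dist_commute)
  qed
  define T where "T = (\<Sum>j\<in>F. g (r j))"
  have T: "real N * P \<le> 4 * (L * T)"
    using bigF by (simp add: T_def R_power sum_distrib_left)
  have "\<exists>j\<in>F. (\<forall>i\<in>I. hit (x i) (d i) j \<longrightarrow> d i < r j) \<and>
    cover_load I x d (c j) (r j) \<le> ennreal (\<kappa> * g (r j))"
  proof (rule ccontr)
    assume contra: "\<not> ?thesis"
    \<comment> \<open>The damage done to member \<open>j\<close> by cover ball \<open>i\<close>, normalised so that a spoiled member receives at
      least its own weight.\<close>
    define w where "w i j = (if i \<in> I \<and> hit (x i) (d i) j then if r j \<le> d i then g (r j) else g (d i) / \<kappa> else 0)"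
      for i j
    have w0: "0 \<le> w i j" for i j
      using g_pos[OF r_pos, of j] g_pos[OF d, of i] \<kappa> by (auto simp: w_def)
    have low: "ennreal (g (r j)) \<le> (\<Sum>i. ennreal (w i j))" if j: "j \<in> F" for j
    proof (cases "\<exists>i\<in>I. hit (x i) (d i) j \<and> r j \<le> d i")
      case True
      then obtain i where i: "i \<in> I" "hit (x i) (d i) j" "r j \<le> d i" by blast
      then have "ennreal (g (r j)) = (\<Sum>i\<in>{i}. ennreal (w i j))" by (simp add: w_def)
      also have "\<dots> \<le> (\<Sum>i. ennreal (w i j))" by (rule sum_le_suminf) auto
      finally show ?thesis .
    next
      case False
      then have "\<not> cover_load I x d (c j) (r j) \<le> ennreal (\<kappa> * g (r j))"
        using contra j by force
      then have "ennreal (\<kappa> * g (r j)) \<le> cover_load I x d (c j) (r j)" by simp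
      then have "ennreal (1 / \<kappa>) * ennreal (\<kappa> * g (r j)) \<le> ennreal (1 / \<kappa>) * cover_load I x d (c j) (r j)"
        by (rule mult_left_mono) simp
      also have "ennreal (1 / \<kappa>) * cover_load I x d (c j) (r j) =
          (\<Sum>i. ennreal (1 / \<kappa>) * (ennreal (g (d i)) * indicator {i\<in>I. dist (c j) (x i) < r j + d i} i))"
        unfolding cover_load_def by (rule ennreal_suminf_cmult[symmetric])
      also have "\<dots> = (\<Sum>i. ennreal (w i j))"
      proof (rule suminf_cong)
        fix i
        show "ennreal (1 / \<kappa>) * (ennreal (g (d i)) * indicator {i\<in>I. dist (c j) (x i) < r j + d i} i)
          = ennreal (w i j)"
        proof (cases "i \<in> I \<and> hit (x i) (d i) j")
          case True
          then have "ennreal (w i j) = ennreal (1 / \<kappa> * g (d i))"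
            using False by (auto simp: w_def)
          also have "\<dots> = ennreal (1 / \<kappa>) * ennreal (g (d i))"
            using \<kappa> by (intro ennreal_mult') auto
          finally show ?thesis using True by (simp add: hit_def)
        next
          case False
          then show ?thesis by (auto simp: w_def hit_def)
        qed
      qed
      also have "ennreal (1 / \<kappa>) * ennreal (\<kappa> * g (r j)) = ennreal (1 / \<kappa> * (\<kappa> * g (r j)))"
        using \<kappa> by (intro ennreal_mult'[symmetric]) auto
      also have "1 / \<kappa> * (\<kappa> * g (r j)) = g (r j)" using \<kappa> by simp
      finally show ?thesis .
    qed
    define B where "B = real N * p * (P / G) + 1 + 1 / \<kappa>"
    have B: "0 \<le> B" unfolding B_def using p P G \<kappa> by simp
    have up: "(\<Sum>j\<in>F. ennreal (w i j)) \<le> ennreal B * (ennreal (g (d i)) * indicator {i\<in>I. dist z (x i) < \<rho> + d i} i)"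
      for i
    proof (cases "i \<in> I \<and> dist z (x i) < \<rho> + d i")
      case False
      then have "w i j = 0" if "j \<in> F" for j using inside[OF that] by (auto simp: w_def)
      then show ?thesis by simp
    next
      case True
      then have di: "0 < d i" using d by simp
      have gd: "0 < g (d i)" using g_pos[OF di] .
      let ?A = "{j. j \<in> F \<and> r j \<le> d i \<and> hit (x i) (d i) j}"
      let ?B = "{j. j \<in> F \<and> \<not> r j \<le> d i \<and> hit (x i) (d i) j}"
      have "(\<Sum>j\<in>F. w i j) = (\<Sum>j\<in>?A \<union> ?B. w i j)"
        using F(1) by (intro sum.mono_neutral_right) (auto simp: w_def)
      also have "\<dots> = (\<Sum>j\<in>?A. w i j) + (\<Sum>j\<in>?B. w i j)"
        using F(1) by (intro sum.union_disjoint) auto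
      also have "(\<Sum>j\<in>?A. w i j) = (\<Sum>j\<in>?A. g (r j))"
        using True by (intro sum.cong) (auto simp: w_def)
      also have "(\<Sum>j\<in>?A. g (r j)) \<le> real N * (p * d i ^ DIM('a)) + g (d i)"
        by (rule hitF[OF di])
      also have "(\<Sum>j\<in>?B. w i j) \<le> g (d i) / \<kappa>"
      proof (cases "?B = {}")
        case True
        then show ?thesis using gd \<kappa> by (simp only: True) simp
      next
        case False
        then obtain k where k: "k \<in> ?B" by blast
        have xin: "x i \<in> cball (c j) (3 * r j)" if "j \<in> ?B" for j
          using that r_pos[of j] by (auto simp: hit_def)
        have "j = k" if "j \<in> ?B" for j
        proof (rule ccontr)
          assume "j \<noteq> k"
          then have "disjnt (cball (c j) (3 * r j)) (cball (c k) (3 * r k))"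
            using pwF that k by (auto simp: pairwise_def)
          then show False using xin[OF that] xin[OF k] by (auto simp: disjnt_def)
        qed
        then have "?B = {k}" using k by blast
        then have "(\<Sum>j\<in>?B. w i j) = w i k" by simp
        also have "\<dots> \<le> g (d i) / \<kappa>" using k gd \<kappa> by (auto simp: w_def)
        finally show ?thesis .
      qed
      also have "real N * (p * d i ^ DIM('a)) \<le> real N * (p * (P / G * g (d i)))"
      proof -
        have "G / P \<le> g (d i) / d i ^ DIM('a)" using ratio True by (simp add: P_def)
        moreover have "0 < d i ^ DIM('a)" using di by simp
        ultimately have "d i ^ DIM('a) \<le> P / G * g (d i)"
          using G P by (simp add: field_simps)
        then show ?thesis using p by (intro mult_left_mono) auto
      qed
      finally have "(\<Sum>j\<in>F. w i j) \<le> B * g (d i)"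
        by (simp add: B_def algebra_simps)
      then have "ennreal (\<Sum>j\<in>F. w i j) \<le> ennreal B * ennreal (g (d i))"
        using B by (simp add: ennreal_mult'[symmetric] ennreal_leI)
      then show ?thesis using True w0 by (simp add: sum_ennreal)
    qed
    have "ennreal T = (\<Sum>j\<in>F. ennreal (g (r j)))"
      unfolding T_def using g_pos[OF r_pos] by (intro sum_ennreal[symmetric]) (auto intro: less_imp_le)
    also have "\<dots> \<le> (\<Sum>j\<in>F. \<Sum>i. ennreal (w i j))" by (intro sum_mono low)
    also have "\<dots> = (\<Sum>i. \<Sum>j\<in>F. ennreal (w i j))" by (intro suminf_sum[symmetric]) auto
    also have "\<dots> \<le> (\<Sum>i. ennreal B * (ennreal (g (d i)) * indicator {i\<in>I. dist z (x i) < \<rho> + d i} i))"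
      by (intro suminf_le up) auto
    also have "\<dots> = ennreal B * cover_load I x d z \<rho>"
      unfolding cover_load_def by (rule ennreal_suminf_cmult)
    also have "\<dots> \<le> ennreal B * ennreal (\<kappa> * G)" by (intro mult_left_mono load) simp
    also have "\<dots> = ennreal (B * (\<kappa> * G))" using B \<kappa> G by (intro ennreal_mult[symmetric]) auto
    finally have "T \<le> B * (\<kappa> * G)" using B \<kappa> G by (subst (asm) ennreal_le_iff) auto
    also have "B * (\<kappa> * G) = real N * P * (\<kappa> * p) + (\<kappa> + 1) * G"
      using G \<kappa> by (simp add: B_def field_simps)
    also have "\<dots> \<le> real N * P * (\<kappa> * p) + 2 * G"
      using \<kappa> G by (intro add_left_mono mult_right_mono) auto
    finally have "L * T \<le> L * (real N * P * (\<kappa> * p) + 2 * G)"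
      using L_pos by (intro mult_left_mono) auto
    also have "\<dots> = real N * P / 16 + 2 * (L * G)"
      unfolding \<kappa>p using L_pos by (simp add: field_simps)
    finally show False using T N G L_pos mult_pos_pos[OF L_pos G] by linarith
  qed
  then show ?thesis using sub F(4) by blast
qed


text \<open>
  Each chosen closed ball lies inside the previous open one, so the common point lies in all of the open
  balls, whose radii tend to zero. A cover ball containing the point would meet every chosen
  ball and so be smaller than all of them.
\<close>

theorem hausdorff_measure_shrunk_limsup:
  assumes "\<Omega> \<noteq> {}"
  shows "hausdorff_measure g {y \<in> \<Omega>. \<forall>e>0. \<exists>j. r j < e \<and> y \<in> ball (c j) (r j)} = \<infinity>"
    (is "hausdorff_measure g ?A = \<infinity>")
proof (rule ccontr)
  assume "hausdorff_measure g ?A \<noteq> \<infinity>"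
  then obtain M0 where M0: "0 \<le> M0" "hausdorff_measure g ?A = ennreal M0"
    by (cases "hausdorff_measure g ?A") auto
  define G where "G = (M0 + 1) / \<kappa>"
  have G: "0 < G" "\<kappa> * G = M0 + 1" using M0(1) \<kappa> by (auto simp: G_def)
  obtain z0 where "z0 \<in> \<Omega>" using assms by blast
  then obtain \<rho> where \<rho>: "0 < \<rho>" "ball z0 \<rho> \<subseteq> \<Omega>"
    using open_\<Omega> by (auto simp: open_contains_ball)
  obtain d0 where d0: "0 < d0" "\<And>x. 0 < x \<Longrightarrow> x < d0 \<Longrightarrow> G / \<rho> ^ DIM('a) \<le> g x / x ^ DIM('a)"
    using g_blowup[of "G / \<rho> ^ DIM('a)"] by blast
  have "hausdorff_premeasure g (d0 / 2) ?A \<le> ennreal M0"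
    using hausdorff_premeasure_le_measure[of "d0 / 2" g ?A] d0(1) M0(2) by simp
  also have "\<dots> < ennreal (M0 + 1)" using M0(1) by (simp add: ennreal_less_iff)
  finally obtain I x d where cover: "\<And>i. i \<in> I \<Longrightarrow> 0 < d i \<and> d i \<le> d0 / 2"
    "?A \<subseteq> (\<Union>i\<in>I. ball (x i) (d i))" "(\<Sum>i. ennreal (g (d i)) * indicator I i) < ennreal (M0 + 1)"
    by (rule hausdorff_premeasure_lessE) blast
  define good where "good j \<longleftrightarrow> ball (c j) (r j) \<subseteq> \<Omega> \<and> (\<forall>i\<in>I. hit (x i) (d i) j \<longrightarrow> d i < r j) \<and>
    cover_load I x d (c j) (r j) \<le> ennreal (\<kappa> * g (r j))" for j
  have "cover_load I x d z0 \<rho> \<le> (\<Sum>i. ennreal (g (d i)) * indicator I i)"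
    unfolding cover_load_def by (intro suminf_le) (auto simp: indicator_def)
  also have "\<dots> \<le> ennreal (\<kappa> * G)" using cover(3) G(2) by simp
  finally have load0: "cover_load I x d z0 \<rho> \<le> ennreal (\<kappa> * G)" .
  have "\<exists>j. cball (c j) (r j) \<subseteq> ball z0 \<rho> \<and> r j < 1 \<and>
    (\<forall>i\<in>I. hit (x i) (d i) j \<longrightarrow> d i < r j) \<and> cover_load I x d (c j) (r j) \<le> ennreal (\<kappa> * g (r j))"
  proof (rule exists_lightly_loaded_ball[OF \<rho>(2,1) _ G(1) load0])
    show "G / \<rho> ^ DIM('a) \<le> g (d i) / d i ^ DIM('a)" if "i \<in> I" for i
      using cover(1)[OF that] d0(1) by (intro d0(2)) auto
  qed (use cover(1) in auto)
  then have start: "\<exists>j. good j"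
    unfolding good_def using \<rho>(2) ball_subset_cball by (meson order.trans)
  have step: "\<exists>k. good k \<and> cball (c k) (r k) \<subseteq> ball (c j) (r j) \<and> r k < r j / 2" if "good j" for j
  proof -
    have "\<exists>k. cball (c k) (r k) \<subseteq> ball (c j) (r j) \<and> r k < r j / 2 \<and>
      (\<forall>i\<in>I. hit (x i) (d i) k \<longrightarrow> d i < r k) \<and> cover_load I x d (c k) (r k) \<le> ennreal (\<kappa> * g (r k))"
    proof (rule exists_lightly_loaded_ball)
      show "ball (c j) (r j) \<subseteq> \<Omega>" "cover_load I x d (c j) (r j) \<le> ennreal (\<kappa> * g (r j))"
        using that by (auto simp: good_def)
      show "0 < r j" "0 < r j / 2" "0 < g (r j)" using r_pos g_pos by auto
      show "0 < d i" if "i \<in> I" for i using cover(1)[OF that] by simp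
      show "g (r j) / r j ^ DIM('a) \<le> g (d i) / d i ^ DIM('a)"
        if "i \<in> I" "dist (c j) (x i) < r j + d i" for i
      proof -
        have "d i < r j" using that \<open>good j\<close> by (auto simp: good_def hit_def)
        then show ?thesis using cover(1)[OF that(1)] by (intro g_anti) auto
      qed
    qed
    then show ?thesis
      unfolding good_def using that[unfolded good_def] ball_subset_cball by (meson order.trans)
  qed
  obtain s where s: "\<And>n. good (s n)" "\<And>n. cball (c (s (Suc n))) (r (s (Suc n))) \<subseteq> ball (c (s n)) (r (s n))"
    "\<And>n. r (s (Suc n)) < r (s n) / 2"
    using dependent_nat_choice[of "\<lambda>n j. good j"
      "\<lambda>n j k. cball (c k) (r k) \<subseteq> ball (c j) (r j) \<and> r k < r j / 2"] start step by metis
  define B where "B n = cball (c (s n)) (r (s n))" for n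
  have "B (Suc n) \<subseteq> B n" for n
    using s(2)[of n] ball_subset_cball unfolding B_def by blast
  then have dec: "B n \<subseteq> B m" if "m \<le> n" for m n
    using that by (rule lift_Suc_antimono_le)
  have "(\<Inter>n. B n) \<noteq> {}"
  proof (rule compact_nest)
    show "compact (B n)" "B n \<noteq> {}" for n using r_pos[of "s n"] by (auto simp: B_def)
  qed (use dec in auto)
  then obtain y where y: "\<And>n. y \<in> B n" by blast
  have yb: "y \<in> ball (c (s n)) (r (s n))" for n
    using y[of "Suc n"] s(2)[of n] unfolding B_def by blast
  have rs: "r (s n) \<le> r (s 0) * (1 / 2) ^ n" for n
  proof (induction n)
    case (Suc n)
    then show ?case using s(3)[of n] by simp
  qed simp
  have small: "\<exists>n. r (s n) < e" if e: "0 < e" for e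
  proof -
    obtain n where "(1 / 2 :: real) ^ n < e / r (s 0)"
      using real_arch_pow_inv[of "e / r (s 0)" "1 / 2"] e r_pos by auto
    then have "r (s 0) * (1 / 2) ^ n < e"
      using r_pos[of "s 0"] by (simp add: field_simps)
    then show ?thesis using rs[of n] by (intro exI[of _ n]) linarith
  qed
  have "y \<in> \<Omega>" using yb[of 0] s(1)[of 0] by (auto simp: good_def)
  then have "y \<in> ?A" using small yb by blast
  then obtain i where i: "i \<in> I" "y \<in> ball (x i) (d i)" using cover(2) by blast
  have lower: "d i < r (s n)" for n
  proof -
    have "hit (x i) (d i) (s n)"
      using yb[of n] i(2) dist_triangle[of "c (s n)" "x i" y] by (simp add: hit_def dist_commute)
    then show ?thesis using s(1)[of n] i(1) by (auto simp: good_def)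
  qed
  obtain n where "r (s n) < d i" using small cover(1)[OF i(1)] by blast
  with lower[of n] show False by simp
qed

end

section \<open>Slicing\<close>

definition column_embed :: "'n::finite \<Rightarrow> real ^ 'm \<Rightarrow> real ^ 'n ^ 'm" where
  "column_embed i0 y = (\<chi> j i. if i = i0 then y $ j else 0)"

lemma column_embed_nth [simp]: "column_embed i0 y $ j $ i = (if i = i0 then y $ j else 0)"
  by (simp add: column_embed_def)

lemma linear_column_embed: "linear (column_embed i0)"
  by (rule linearI) (auto simp: vec_eq_iff)

lemma continuous_on_column_embed: "continuous_on S (column_embed i0)"
  by (rule linear_continuous_on) (simp add: linear_column_embed linear_conv_bounded_linear[symmetric])

lemma Basis_matrix: "(Basis :: (real ^ 'n ^ 'm) set) = (\<lambda>(j, i). axis j (axis i 1)) ` UNIV"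
  by (auto simp: Basis_vec_def image_iff)

lemma inj_axis_axis: "inj (\<lambda>(j :: 'm::finite, i :: 'n::finite). axis j (axis i (1::real)))"
  by (auto simp: inj_def axis_eq_axis)

lemma mem_box_matrix:
  fixes X :: "real ^ 'n ^ 'm"
  shows "X \<in> box a b \<longleftrightarrow> (\<forall>j i. a $ j $ i < X $ j $ i \<and> X $ j $ i < b $ j $ i)"
  by (auto simp: mem_box Basis_matrix inner_axis)

lemma emeasure_box_matrix:
  fixes a b :: "real ^ 'n ^ 'm"
  assumes "\<And>j i. a $ j $ i \<le> b $ j $ i"
  shows "emeasure lborel (box a b) = ennreal (\<Prod>j\<in>UNIV. \<Prod>i\<in>UNIV. b $ j $ i - a $ j $ i)"
proof -
  have "emeasure lborel (box a b) = ennreal (\<Prod>B\<in>Basis. (b - a) \<bullet> B)"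
    using assms by (intro emeasure_lborel_box) (auto simp: Basis_matrix inner_axis)
  also have "(\<Prod>B\<in>Basis. (b - a) \<bullet> B) = (\<Prod>(j, i)\<in>UNIV. b $ j $ i - a $ j $ i)"
    unfolding Basis_matrix by (subst prod.reindex[OF inj_axis_axis]) (auto simp: inner_axis intro!: prod.cong)
  also have "\<dots> = (\<Prod>j\<in>UNIV. \<Prod>i\<in>UNIV. b $ j $ i - a $ j $ i)"
    by (simp add: prod.cartesian_product)
  finally show ?thesis .
qed

text \<open>
  The box contains every point of the open unit cube for which varying column \<open>i0\<close> leads into the ball
  of radius \<open>d\<close> about \<open>c\<close>.
\<close>

lemma emeasure_column_tube:
  fixes c :: "real ^ 'n ^ 'm"
  assumes "0 < d"
  shows "emeasure lborel (box (\<chi> j i. if i = i0 then 0 else c $ j $ i - d) (\<chi> j i. if i = i0 then 1 else c $ j $ i + d))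
    = ennreal ((2 * d) ^ ((CARD('n) - 1) * CARD('m)))"
proof -
  have "(\<Prod>i\<in>UNIV. if i = i0 then 1 else 2 * d) = (2 * d) ^ (CARD('n) - 1)"
  proof -
    have "(\<Prod>i\<in>UNIV. if i = i0 then 1 else 2 * d) = (\<Prod>i\<in>UNIV - {i0}. 2 * d)"
      by (rule prod.mono_neutral_cong_right) auto
    then show ?thesis by simp
  qed
  then have p: "(\<Prod>i\<in>UNIV. (if i = i0 then 1 else c $ j $ i + d) - (if i = i0 then 0 else c $ j $ i - d))
    = (2 * d) ^ (CARD('n) - 1)" for j
    by (subst (asm) prod.cong[OF refl, where h = "\<lambda>i. (if i = i0 then 1 else c $ j $ i + d) - (if i = i0 then 0 else c $ j $ i - d)"]) auto
  show ?thesis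
    using assms by (subst emeasure_box_matrix) (auto simp: p power_mult)
qed

lemma norm_column_le:
  fixes X :: "real ^ 'n ^ 'm"
  shows "norm (\<chi> j. X $ j $ i) \<le> norm X"
  unfolding norm_vec_def[of X] norm_vec_def[of "\<chi> j. X $ j $ i"]
  by (rule L2_set_mono) (use component_le_norm_cart in auto)

lemma abs_entry_le_norm:
  fixes X :: "real ^ 'n ^ 'm"
  shows "\<bar>X $ j $ i\<bar> \<le> norm X"
  using component_le_norm_cart[of "X $ j" i] Finite_Cartesian_Product.norm_nth_le[of X j] by linarith

lemma hausdorff_premeasure_tendsto:
  assumes "hausdorff_measure f A = \<infinity>"
  shows "\<forall>\<^sub>F n in sequentially. ennreal K \<le> hausdorff_premeasure f (1 / real (Suc n)) A"
proof -
  have "ennreal K < (SUP \<rho>\<in>{0<..}. hausdorff_premeasure f \<rho> A)"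
    unfolding hausdorff_measure_def[symmetric] assms by simp
  then obtain \<rho> where \<rho>: "0 < \<rho>" "ennreal K < hausdorff_premeasure f \<rho> A"
    by (auto simp: less_SUP_iff)
  obtain m where m: "1 / real (Suc m) < \<rho>" using nat_approx_posE[OF \<rho>(1)] by blast
  show ?thesis
  proof (rule eventually_sequentiallyI)
    fix n assume "m \<le> n"
    then have "1 / real (Suc n) \<le> 1 / real (Suc m)" by (intro divide_left_mono) auto
    then have "hausdorff_premeasure f \<rho> A \<le> hausdorff_premeasure f (1 / real (Suc n)) A"
      using m by (intro hausdorff_premeasure_antimono) simp
    then show "ennreal K \<le> hausdorff_premeasure f (1 / real (Suc n)) A" using \<rho>(2) by simp
  qed
qed

text \<open>
  A cover of \<open>A\<close> by balls of radii \<open>d i\<close> induces covers of all slices, and the slices that meet a given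
  ball form a set of measure at most \<open>(2 * d i) ^ l\<close>. So the integral over the slices of the
  \<open>g\<close>-sums of the induced covers is at most \<open>2 ^ l\<close> times the \<open>f\<close>-sum of the cover. If
  the measure of \<open>A\<close> were finite, then for finer and finer covers these integrals would stay bounded,
  while the integrands tend to infinity almost everywhere, against Fatou's lemma.

  Slices are parametrised by all \<open>X\<close> of the full space instead of the entries outside column \<open>i0\<close>: the
  additional \<open>m\<close> coordinates contribute a factor \<open>1\<close>, and almost all slices means almost all \<open>X\<close>
  for the Lebesgue measure of the full space.
\<close>

theorem hausdorff_measure_infinite_if_slices:
  fixes A :: "(real ^ 'n::finite ^ 'm::finite) set" and i0 :: "'n::finite"
  assumes fg: "\<And>r. 0 < r \<Longrightarrow> 0 \<le> g r \<and> f r = r ^ ((CARD('n) - 1) * CARD('m)) * g r"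
    and slices: "AE X in lborel. X \<in> box 0 (\<chi> j i. 1) \<longrightarrow> hausdorff_measure g {y. X + column_embed i0 y \<in> A} = \<infinity>"
  shows "hausdorff_measure f A = \<infinity>"
proof (rule ccontr)
  assume "hausdorff_measure f A \<noteq> \<infinity>"
  then obtain M where M: "0 \<le> M" "hausdorff_measure f A = ennreal M"
    by (cases "hausdorff_measure f A") auto
  let ?l = "(CARD('n) - 1) * CARD('m)"
  let ?C = "box 0 (\<chi> j i. 1) :: (real ^ 'n ^ 'm) set"
  define Q where "Q n I c d \<longleftrightarrow> (\<forall>i\<in>I. 0 < d i \<and> d i \<le> 1 / real (Suc n)) \<and>
    A \<subseteq> (\<Union>i\<in>I. ball (c i) (d i)) \<and> (\<Sum>i. ennreal (f (d i)) * indicator I i) < ennreal (M + 1)"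
    for n and I :: "nat set" and c d
  have "\<exists>I c d. Q n I c d" for n
  proof -
    have "hausdorff_premeasure f (1 / real (Suc n)) A \<le> ennreal M"
      using hausdorff_premeasure_le_measure[of "1 / real (Suc n)" f A] M(2) by simp
    also have "\<dots> < ennreal (M + 1)" using M(1) by (simp add: ennreal_less_iff)
    finally show ?thesis unfolding Q_def by (rule hausdorff_premeasure_lessE) blast
  qed
  then obtain I c d where Q: "\<And>n. Q n (I n) (c n) (d n)" by metis
  then have cover: "\<And>n i. i \<in> I n \<Longrightarrow> 0 < d n i \<and> d n i \<le> 1 / real (Suc n)"
      "\<And>n. A \<subseteq> (\<Union>i\<in>I n. ball (c n i) (d n i))"
      "\<And>n. (\<Sum>i. ennreal (f (d n i)) * indicator (I n) i) < ennreal (M + 1)"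
    unfolding Q_def by blast+
  \<comment> \<open>\<open>\<phi> n X\<close> is the \<open>g\<close>-sum of the cover that the \<open>n\<close>-th cover of \<open>A\<close> induces on the slice through \<open>X\<close>.\<close>
  define T where "T n i = box (\<chi> j k. if k = i0 then 0 else c n i $ j $ k - d n i)
    (\<chi> j k. if k = i0 then 1 else c n i $ j $ k + d n i)" for n i
  define \<phi> where "\<phi> n X = (\<Sum>i. ennreal (g (d n i)) * indicator (I n) i * indicator (T n i) X)" for n X
  have T [measurable]: "T n i \<in> sets borel" for n i by (simp add: T_def)
  have meas: "\<phi> n \<in> borel_measurable lborel" for n
    unfolding \<phi>_def by measurable
  have int: "(\<integral>\<^sup>+X. \<phi> n X \<partial>lborel) \<le> ennreal (2 ^ ?l * (M + 1))" for n
  proof -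
    have "(\<integral>\<^sup>+X. \<phi> n X \<partial>lborel) = (\<Sum>i. \<integral>\<^sup>+X. ennreal (g (d n i)) * indicator (I n) i * indicator (T n i) X \<partial>lborel)"
      unfolding \<phi>_def by (intro nn_integral_suminf) measurable
    also have "\<dots> = (\<Sum>i. ennreal (g (d n i)) * indicator (I n) i * emeasure lborel (T n i))"
      by (intro suminf_cong nn_integral_cmult_indicator) (simp add: T)
    also have "\<dots> = (\<Sum>i. ennreal (2 ^ ?l) * (ennreal (f (d n i)) * indicator (I n) i))"
    proof (rule suminf_cong)
      fix i
      show "ennreal (g (d n i)) * indicator (I n) i * emeasure lborel (T n i)
        = ennreal (2 ^ ?l) * (ennreal (f (d n i)) * indicator (I n) i)"
      proof (cases "i \<in> I n")
        case True
        then have d: "0 < d n i" using cover(1) by simp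
        have "ennreal (g (d n i)) * emeasure lborel (T n i) = ennreal (g (d n i) * (2 * d n i) ^ ?l)"
          unfolding T_def emeasure_column_tube[OF d] using fg[OF d] d by (simp add: ennreal_mult)
        also have "g (d n i) * (2 * d n i) ^ ?l = 2 ^ ?l * f (d n i)"
          using fg[OF d] by (simp add: power_mult_distrib mult_ac)
        also have "ennreal \<dots> = ennreal (2 ^ ?l) * ennreal (f (d n i))"
          by (rule ennreal_mult') simp
        finally show ?thesis using True by simp
      qed simp
    qed
    also have "\<dots> = ennreal (2 ^ ?l) * (\<Sum>i. ennreal (f (d n i)) * indicator (I n) i)"
      by (rule ennreal_suminf_cmult)
    also have "\<dots> \<le> ennreal (2 ^ ?l) * ennreal (M + 1)"
      using cover(3)[of n] by (intro mult_left_mono) auto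
    also have "\<dots> = ennreal (2 ^ ?l * (M + 1))" by (rule ennreal_mult'[symmetric]) simp
    finally show ?thesis .
  qed
  have le\<phi>: "hausdorff_premeasure g (1 / real (Suc n)) {y. X + column_embed i0 y \<in> A} \<le> \<phi> n X"
    if X: "X \<in> ?C" for n X
  proof -
    let ?I = "{i \<in> I n. X \<in> T n i}"
    have "{y. X + column_embed i0 y \<in> A} \<subseteq> (\<Union>i\<in>?I. ball (\<chi> j. c n i $ j $ i0 - X $ j $ i0) (d n i))"
    proof
      fix y assume "y \<in> {y. X + column_embed i0 y \<in> A}"
      then obtain i where i: "i \<in> I n" "X + column_embed i0 y \<in> ball (c n i) (d n i)"
        using cover(2)[of n] by blast
      define D where "D = c n i - (X + column_embed i0 y)"
      have D: "norm D < d n i" using i(2) by (simp add: D_def dist_norm)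
      have "X \<in> T n i"
        unfolding T_def mem_box_matrix
      proof (intro allI)
        fix j k
        have "\<bar>D $ j $ k\<bar> < d n i" using abs_entry_le_norm[of D j k] D by linarith
        then show "(\<chi> j k. if k = i0 then 0 else c n i $ j $ k - d n i) $ j $ k < X $ j $ k \<and>
          X $ j $ k < (\<chi> j k. if k = i0 then 1 else c n i $ j $ k + d n i) $ j $ k"
          using X by (auto simp: mem_box_matrix D_def abs_less_iff)
      qed
      moreover have "(\<chi> j. c n i $ j $ i0 - X $ j $ i0) - y = (\<chi> j. D $ j $ i0)"
        by (simp add: vec_eq_iff D_def)
      then have "y \<in> ball (\<chi> j. c n i $ j $ i0 - X $ j $ i0) (d n i)"
        using norm_column_le[of D i0] D by (simp add: dist_norm)
      ultimately show "y \<in> (\<Union>i\<in>?I. ball (\<chi> j. c n i $ j $ i0 - X $ j $ i0) (d n i))"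
        using i(1) by blast
    qed
    then have "hausdorff_premeasure g (1 / real (Suc n)) {y. X + column_embed i0 y \<in> A}
      \<le> (\<Sum>i. ennreal (g (d n i)) * indicator ?I i)"
      using cover(1) by (intro hausdorff_premeasure_le_suminf) auto
    also have "\<dots> = \<phi> n X"
      unfolding \<phi>_def by (intro suminf_cong) (auto simp: indicator_def)
    finally show ?thesis .
  qed
  have "AE X in lborel. \<infinity> * indicator ?C X \<le> liminf (\<lambda>n. \<phi> n X)"
    using slices
  proof eventually_elim
    case (elim X)
    show ?case
    proof (cases "X \<in> ?C")
      case True
      have unbounded: "ennreal K \<le> liminf (\<lambda>n. \<phi> n X)" for K
      proof (rule Liminf_bounded)
        have "hausdorff_measure g {y. X + column_embed i0 y \<in> A} = \<infinity>" using elim True by blast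
        from hausdorff_premeasure_tendsto[OF this, of K]
        show "\<forall>\<^sub>F n in sequentially. ennreal K \<le> \<phi> n X"
          by eventually_elim (use le\<phi>[OF True] in \<open>blast intro: order.trans\<close>)
      qed
      have "liminf (\<lambda>n. \<phi> n X) = \<infinity>"
      proof (cases "liminf (\<lambda>n. \<phi> n X)")
        case (real K)
        then show ?thesis using unbounded[of "K + 1"] by (simp add: ennreal_le_iff)
      qed simp
      then show ?thesis by simp
    qed simp
  qed
  then have "(\<integral>\<^sup>+X. \<infinity> * indicator ?C X \<partial>lborel) \<le> (\<integral>\<^sup>+X. liminf (\<lambda>n. \<phi> n X) \<partial>lborel)"
    by (rule nn_integral_mono_AE)
  also have "\<dots> \<le> liminf (\<lambda>n. \<integral>\<^sup>+X. \<phi> n X \<partial>lborel)"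
    by (intro nn_integral_liminf meas)
  also have "\<dots> \<le> ennreal (2 ^ ?l * (M + 1))"
    using int by (intro Liminf_le) auto
  finally have "(\<integral>\<^sup>+X. \<infinity> * indicator ?C X \<partial>lborel) < \<infinity>"
    by (auto simp: less_top[symmetric] top_unique)
  moreover have "(\<integral>\<^sup>+X. \<infinity> * indicator ?C X \<partial>lborel) = \<infinity> * emeasure lborel ?C"
    by (rule nn_integral_cmult_indicator) simp
  moreover have "emeasure lborel ?C = 1"
    by (subst emeasure_box_matrix) auto
  ultimately show False by simp
qed

text \<open>
  For fixed \<open>y\<close>, the set of \<open>X\<close> with \<open>X + column_embed i0 y\<close> in a null set is a translate of that null
  set. Interchange of the almost-everywhere quantifiers gives the claim.
\<close>

theorem AE_slices_negligible:
  fixes N :: "(real ^ 'n::finite ^ 'm::finite) set" and i0 :: "'n::finite"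
  assumes "negligible N"
  shows "AE X in lborel. negligible {y. X + column_embed i0 y \<in> N}"
proof -
  obtain N' where N': "N' \<in> null_sets lborel" "N \<subseteq> N'"
    using assms by (auto simp: negligible_iff_null_sets null_sets_completion_iff2)
  have N'b: "N' \<in> sets borel" using N'(1) by auto
  have "continuous_on UNIV (\<lambda>p :: (real ^ 'n ^ 'm) \<times> (real ^ 'm). fst p + column_embed i0 (snd p))"
    by (intro continuous_intros continuous_on_compose2[OF continuous_on_column_embed[of UNIV]]) auto
  then have cont: "(\<lambda>p :: (real ^ 'n ^ 'm) \<times> (real ^ 'm). fst p + column_embed i0 (snd p)) \<in> borel_measurable (lborel \<Otimes>\<^sub>M lborel)"
    unfolding lborel_prod by (simp add: borel_measurable_continuous_onI)
  have "(AE X in lborel. AE y in lborel. X + column_embed i0 y \<notin> N') \<longleftrightarrow>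
        (AE y in lborel. AE X in lborel. X + column_embed i0 y \<notin> N')"
  proof (rule lborel_pair.AE_commute)
    have "(\<lambda>p. fst p + column_embed i0 (snd p)) -` (- N') \<inter> space (lborel \<Otimes>\<^sub>M lborel) \<in> sets (lborel \<Otimes>\<^sub>M lborel)"
      using N'b by (intro measurable_sets[OF cont]) auto
    then show "{x \<in> space (lborel \<Otimes>\<^sub>M lborel). fst x + column_embed i0 (snd x) \<notin> N'} \<in> sets (lborel \<Otimes>\<^sub>M lborel)"
      by (simp add: vimage_def Int_def conj_commute)
  qed
  moreover have "AE X in lborel. X + column_embed i0 y \<notin> N'" for y
  proof (rule AE_I')
    have "{X. X + column_embed i0 y \<in> N'} = (+) (- column_embed i0 y) ` N'"
      by (force simp: image_iff algebra_simps)
    moreover have "negligible ((+) (- column_embed i0 y) ` N')"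
      using N'(1) by (intro negligible_translation) (simp add: negligible_iff_null_sets null_sets_completionI)
    moreover have "{X. X + column_embed i0 y \<in> N'} \<in> sets borel"
      using N'b by measurable
    ultimately show "{X. X + column_embed i0 y \<in> N'} \<in> null_sets lborel"
      by (simp add: negligible_iff_null_sets null_sets_completion_iff)
  qed auto
  ultimately have "AE X in lborel. AE y in lborel. X + column_embed i0 y \<notin> N'" by simp
  then show ?thesis
  proof eventually_elim
    case (elim X)
    then obtain Z where Z: "Z \<in> null_sets lborel" "{y. X + column_embed i0 y \<in> N'} \<subseteq> Z"
      by (auto simp: eventually_ae_filter)
    have "negligible Z" using Z(1) by (simp add: negligible_iff_null_sets null_sets_completionI)
    then show ?case by (rule negligible_subset) (use Z(2) N'(2) in blast)
  qed
qed

section \<open>Integer vectors and linear forms on slices\<close>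

lemma abs_entry_le_sup_norm: "real_of_int \<bar>a $ i\<bar> \<le> sup_norm a"
  using component_le_infnorm_cart[of "real_vec a" i] by (simp add: sup_norm_def real_vec_def)

lemma sup_norm_attained: "\<exists>i. real_of_int \<bar>a $ i\<bar> = sup_norm a"
proof -
  have "{\<bar>real_vec a $ i\<bar> | i. i \<in> UNIV} = range (\<lambda>i. \<bar>real_vec a $ i\<bar>)" by auto
  then have "sup_norm a = Max (range (\<lambda>i. \<bar>real_vec a $ i\<bar>))"
    unfolding sup_norm_def infnorm_cart by (simp add: cSup_eq_Max)
  moreover have "Max (range (\<lambda>i. \<bar>real_vec a $ i\<bar>)) \<in> range (\<lambda>i. \<bar>real_vec a $ i\<bar>)"
    by (rule Max_in) auto
  ultimately obtain i where "sup_norm a = \<bar>real_vec a $ i\<bar>" by fastforce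
  then show ?thesis by (intro exI[of _ i]) (simp add: real_vec_def)
qed

lemma sup_norm_ge_1:
  assumes "a \<noteq> 0" shows "1 \<le> sup_norm a"
proof -
  obtain i where "a $ i \<noteq> 0" using assms by (auto simp: vec_eq_iff)
  then have "1 \<le> real_of_int \<bar>a $ i\<bar>" by linarith
  then show ?thesis using abs_entry_le_sup_norm[of a i] by linarith
qed

lemma finite_sup_norm_le: "finite {a :: int ^ 'n. sup_norm a \<le> N}"
proof -
  let ?S = "{- \<lceil>N\<rceil>..\<lceil>N\<rceil>}"
  have "{a :: int ^ 'n. sup_norm a \<le> N} \<subseteq> vec_lambda ` (PiE UNIV (\<lambda>_. ?S))"
  proof
    fix a :: "int ^ 'n" assume "a \<in> {a. sup_norm a \<le> N}"
    then have "a $ i \<in> ?S" for i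
      using abs_entry_le_sup_norm[of a i] by (auto simp: abs_le_iff) linarith+
    then have "vec_nth a \<in> PiE UNIV (\<lambda>_. ?S)" by auto
    then show "a \<in> vec_lambda ` (PiE UNIV (\<lambda>_. ?S))"
      by (metis image_eqI vec_nth_inverse)
  qed
  then show ?thesis by (rule finite_subset) (intro finite_imageI finite_PiE, auto)
qed

lemma tends_to_zero_iff_finite:
  assumes "\<And>a. 0 \<le> \<Psi> a"
  shows "tends_to_zero \<Psi> \<longleftrightarrow> (\<forall>e>0. finite {a. e \<le> \<Psi> a})"
proof
  assume *: "tends_to_zero \<Psi>"
  show "\<forall>e>0. finite {a. e \<le> \<Psi> a}"
  proof (intro allI impI)
    fix e :: real assume "0 < e"
    then have "\<forall>\<^sub>F a in filtercomap sup_norm at_top. \<Psi> a < e"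
      using * unfolding tends_to_zero_def by (rule order_tendstoD(2)[rotated])
    then obtain N where N: "\<And>a. N \<le> sup_norm a \<Longrightarrow> \<Psi> a < e"
      by (auto simp: eventually_filtercomap_at_top_linorder)
    have "{a. e \<le> \<Psi> a} \<subseteq> {a. sup_norm a \<le> N}"
      using N by (smt (verit) Collect_mono)
    then show "finite {a. e \<le> \<Psi> a}" by (rule finite_subset) (rule finite_sup_norm_le)
  qed
next
  assume *: "\<forall>e>0. finite {a. e \<le> \<Psi> a}"
  show "tends_to_zero \<Psi>"
    unfolding tends_to_zero_def tendsto_iff
  proof (intro allI impI)
    fix e :: real assume "0 < e"
    then have fin: "finite {a. e \<le> \<Psi> a}" using * by blast
    define N where "N = Max (insert 0 (sup_norm ` {a. e \<le> \<Psi> a})) + 1"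
    have "dist (\<Psi> a) 0 < e" if "N \<le> sup_norm a" for a
    proof (rule ccontr)
      assume "\<not> dist (\<Psi> a) 0 < e"
      then have "e \<le> \<Psi> a" using assms[of a] by simp
      then have "sup_norm a \<le> Max (insert 0 (sup_norm ` {a. e \<le> \<Psi> a}))"
        using fin by (intro Max_ge) auto
      then show False using that by (simp add: N_def)
    qed
    then show "\<forall>\<^sub>F a in filtercomap sup_norm at_top. dist (\<Psi> a) 0 < e"
      by (auto simp: eventually_filtercomap_at_top_linorder)
  qed
qed

lemma dist_nearest_int_less_iff: "dist_nearest_int x < e \<longleftrightarrow> (\<exists>p. \<bar>x - real_of_int p\<bar> < e)"
proof
  assume *: "dist_nearest_int x < e"
  obtain y where "y \<in> \<int>" "infdist x \<int> = dist x y"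
    using infdist_attains_inf[of "\<int> :: real set" x] closed_Ints by (metis Ints_0 empty_iff)
  then show "\<exists>p. \<bar>x - real_of_int p\<bar> < e"
    using * by (auto simp: dist_nearest_int_def dist_real_def elim!: Ints_cases)
next
  assume "\<exists>p. \<bar>x - real_of_int p\<bar> < e"
  then obtain p where "\<bar>x - real_of_int p\<bar> < e" ..
  moreover have "infdist x \<int> \<le> dist x (real_of_int p)" by (rule infdist_le) simp
  ultimately show "dist_nearest_int x < e" by (simp add: dist_nearest_int_def dist_real_def)
qed

lemma inner_add_column_embed:
  "real_vec a \<bullet> (X + column_embed i0 y) $ j = real_vec a \<bullet> X $ j + real_of_int (a $ i0) * y $ j"
proof -
  have "column_embed i0 y $ j = axis i0 (y $ j)" by (simp add: vec_eq_iff axis_def)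
  then show ?thesis by (simp add: inner_add_right inner_axis real_vec_def)
qed

text \<open>
  On a slice the linear form \<open>real_vec a \<bullet> X $ j\<close> depends on \<open>y $ j\<close> with slope \<open>a $ i0\<close>, so the system of
  inequalities says that \<open>y\<close> lies in one of the cubes, with centres indexed by \<open>p\<close>, of half side
  \<open>e / |a $ i0|\<close>.
\<close>

lemma approximable_on_slice_iff:
  fixes X :: "real ^ 'n ^ 'm"
  assumes "a $ i0 \<noteq> 0"
  shows "(\<forall>j. dist_nearest_int (real_vec a \<bullet> (X + column_embed i0 y) $ j - b $ j) < e) \<longleftrightarrow>
    (\<exists>p :: int ^ 'm. \<forall>j. \<bar>y $ j - (real_of_int (p $ j) + b $ j - real_vec a \<bullet> X $ j) / real_of_int (a $ i0)\<bar>
       < e / real_of_int \<bar>a $ i0\<bar>)"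
proof -
  let ?A = "real_of_int (a $ i0)"
  have key: "\<bar>real_vec a \<bullet> (X + column_embed i0 y) $ j - b $ j - real_of_int p\<bar> < e \<longleftrightarrow>
    \<bar>y $ j - (real_of_int p + b $ j - real_vec a \<bullet> X $ j) / ?A\<bar> < e / real_of_int \<bar>a $ i0\<bar>" for j p
  proof -
    have "real_vec a \<bullet> (X + column_embed i0 y) $ j - b $ j - real_of_int p =
      ?A * (y $ j - (real_of_int p + b $ j - real_vec a \<bullet> X $ j) / ?A)"
      unfolding inner_add_column_embed using assms by (simp add: field_simps)
    then show ?thesis using assms by (simp add: abs_mult pos_less_divide_eq mult.commute)
  qed
  show ?thesis
  proof
    assume "\<forall>j. dist_nearest_int (real_vec a \<bullet> (X + column_embed i0 y) $ j - b $ j) < e"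
    then have "\<forall>j. \<exists>p. \<bar>real_vec a \<bullet> (X + column_embed i0 y) $ j - b $ j - real_of_int p\<bar> < e"
      unfolding dist_nearest_int_less_iff .
    then obtain p where "\<And>j. \<bar>real_vec a \<bullet> (X + column_embed i0 y) $ j - b $ j - real_of_int (p j)\<bar> < e"
      by metis
    then show "\<exists>p :: int ^ 'm. \<forall>j. \<bar>y $ j - (real_of_int (p $ j) + b $ j - real_vec a \<bullet> X $ j) / ?A\<bar>
       < e / real_of_int \<bar>a $ i0\<bar>"
      unfolding key by (intro exI[of _ "\<chi> j. p j"]) simp
  qed (use key dist_nearest_int_less_iff in blast)
qed

lemma norm_le_sqrt_card:
  fixes y :: "real ^ 'm"
  assumes "\<And>j. \<bar>y $ j\<bar> \<le> B" "0 \<le> B"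
  shows "norm y \<le> sqrt CARD('m) * B"
proof -
  have "(norm y)\<^sup>2 = (\<Sum>j\<in>UNIV. (y $ j)\<^sup>2)"
    by (simp add: norm_vec_def L2_set_def sum_nonneg)
  also have "\<dots> \<le> (\<Sum>j\<in>(UNIV :: 'm set). B\<^sup>2)"
    using assms by (intro sum_mono) (simp add: abs_le_square_iff[symmetric])
  also have "\<dots> = (sqrt CARD('m) * B)\<^sup>2" by (simp add: power_mult_distrib)
  finally show ?thesis by (rule power2_le_imp_le) (use assms in simp)
qed

lemma open_unit_cube_subset: "box 0 (\<chi> j i. 1) \<subseteq> half_open_cube"
  by (auto simp: mem_box_matrix half_open_cube_def less_imp_le)

lemma negligible_cube_minus_full:
  fixes W :: "(real ^ 'n ^ 'm) set"
  assumes W: "emeasure lebesgue W = 1" "W \<subseteq> half_open_cube"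
  shows "negligible (half_open_cube - W)"
proof -
  let ?C = "cbox 0 (\<chi> j i. 1) :: (real ^ 'n ^ 'm) set"
  have le: "0 \<bullet> B \<le> ((\<chi> j i. 1) :: real ^ 'n ^ 'm) \<bullet> B" if "B \<in> Basis" for B
    using that by (auto simp: Basis_matrix inner_axis)
  have "emeasure lborel ?C = emeasure lborel (box 0 (\<chi> j i. 1) :: (real ^ 'n ^ 'm) set)"
    unfolding emeasure_lborel_cbox_eq emeasure_lborel_box_eq ..
  also have "\<dots> = 1" by (subst emeasure_box_matrix) auto
  finally have C: "emeasure lebesgue ?C = 1" by simp
  have sub: "half_open_cube \<subseteq> ?C"
    by (auto simp: half_open_cube_def mem_box Basis_matrix inner_axis less_imp_le)
  have Ws: "W \<in> sets lebesgue" using W(1) emeasure_notin_sets by force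
  have "emeasure lebesgue (?C - W) = emeasure lebesgue ?C - emeasure lebesgue W"
    using Ws W sub by (intro emeasure_Diff) auto
  then have "emeasure lebesgue (?C - W) = 0" using C W(1) by simp
  moreover have "?C - W \<in> sets lebesgue" using Ws by (intro sets.Diff) auto
  ultimately have "negligible (?C - W)"
    by (simp add: negligible_iff_null_sets null_sets_def)
  then show ?thesis by (rule negligible_subset) (use sub in blast)
qed


section \<open>Dimension functions dominated by Lebesgue measure\<close>

text \<open>
  The two sets differ by a Lebesgue null set, which for such an \<open>f\<close> has vanishing Hausdorff premeasures.
\<close>

lemma hausdorff_measure_full_subset:
  fixes W :: "(real ^ 'n ^ 'm) set"
  assumes W: "emeasure lebesgue W = 1" "W \<subseteq> half_open_cube" and r0: "0 < r0"
    and f: "\<And>x. 0 < x \<Longrightarrow> x \<le> r0 \<Longrightarrow> 0 \<le> f x \<and> f x \<le> K * x ^ (CARD('n) * CARD('m))"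
  shows "hausdorff_measure f W = hausdorff_measure f (half_open_cube :: (real ^ 'n ^ 'm) set)"
proof (rule antisym)
  show "hausdorff_measure f W \<le> hausdorff_measure f (half_open_cube :: (real ^ 'n ^ 'm) set)"
    using W(2) by (rule hausdorff_measure_mono)
  have "hausdorff_premeasure f \<rho> (half_open_cube :: (real ^ 'n ^ 'm) set) \<le> hausdorff_measure f W"
    if \<rho>: "0 < \<rho>" for \<rho>
  proof -
    have "hausdorff_premeasure f \<rho> (half_open_cube - W) = 0"
      using negligible_cube_minus_full[OF W] \<rho> r0
    proof (rule hausdorff_premeasure_negligible)
      show "0 \<le> f x \<and> f x \<le> K * x ^ DIM(real ^ 'n ^ 'm)" if "0 < x" "x \<le> r0" for x
        using f[OF that] by (simp add: mult.commute)
    qed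
    then have "hausdorff_premeasure f \<rho> (W \<union> (half_open_cube - W)) \<le> hausdorff_premeasure f \<rho> W"
      by (rule hausdorff_premeasure_Un_null)
    also have "W \<union> (half_open_cube - W) = half_open_cube" using W(2) by blast
    finally show ?thesis using hausdorff_premeasure_le_measure[OF \<rho>, of f W] by (rule order.trans)
  qed
  then show "hausdorff_measure f (half_open_cube :: (real ^ 'n ^ 'm) set) \<le> hausdorff_measure f W"
    unfolding hausdorff_measure_def[of f half_open_cube] by (intro SUP_least) auto
qed

text \<open>
  The comparison of the two series is allowed to fail at finitely many \<open>a\<close>, where \<open>\<Psi> a\<close> is too large for
  the bound on the dimension function.
\<close>

lemma divergence_of_power_series:
  fixes \<Psi> t :: "int ^ 'n \<Rightarrow> real"
  assumes \<Psi>: "\<And>a. 0 \<le> \<Psi> a" and fin: "finite {a. r0 < \<Psi> a}"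
    and t: "\<And>a. a \<noteq> 0 \<Longrightarrow> \<Psi> a \<le> r0 \<Longrightarrow> t a \<le> K * \<Psi> a ^ m" and t0: "\<And>a. 0 \<le> t a"
    and div: "(\<Sum>\<^sub>\<infinity>a\<in>UNIV - {0}. ennreal (t a)) = \<infinity>"
  shows "(\<Sum>\<^sub>\<infinity>a\<in>UNIV. ennreal (\<Psi> a ^ m)) = \<infinity>"
proof -
  define K' where "K' = max K 1"
  have K': "0 < K'" "K \<le> K'" by (auto simp: K'_def)
  let ?E = "{a. r0 < \<Psi> a}"
  have "\<exists>F. finite F \<and> F \<subseteq> UNIV \<and> M \<le> (\<Sum>a\<in>F. \<Psi> a ^ m)" for M
  proof -
    have "\<exists>F. finite F \<and> F \<subseteq> UNIV - {0} \<and> sum t ?E + K' * M \<le> sum t F"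
      using div infsum_ennreal_eq_top_iff[of "UNIV - {0}" t] t0 by blast
    then obtain F where F: "finite F" "F \<subseteq> UNIV - {0}" "sum t ?E + K' * M \<le> sum t F" by blast
    have "sum t F = sum t (F \<inter> ?E) + sum t (F - ?E)" using F(1) by (metis sum.Int_Diff)
    also have "sum t (F \<inter> ?E) \<le> sum t ?E" using fin t0 by (intro sum_mono2) auto
    also have "sum t (F - ?E) \<le> (\<Sum>a\<in>F - ?E. K' * \<Psi> a ^ m)"
    proof (rule sum_mono)
      fix a assume "a \<in> F - ?E"
      then have "t a \<le> K * \<Psi> a ^ m" using F(2) by (intro t) auto
      also have "\<dots> \<le> K' * \<Psi> a ^ m" using K' \<Psi> by (intro mult_right_mono) auto
      finally show "t a \<le> K' * \<Psi> a ^ m" .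
    qed
    also have "\<dots> = K' * (\<Sum>a\<in>F - ?E. \<Psi> a ^ m)" by (simp add: sum_distrib_left)
    finally have "K' * M \<le> K' * (\<Sum>a\<in>F - ?E. \<Psi> a ^ m)" using F(3) by simp
    then have "M \<le> (\<Sum>a\<in>F - ?E. \<Psi> a ^ m)" using K' by simp
    then show ?thesis using F(1) by (intro exI[of _ "F - ?E"]) auto
  qed
  then show ?thesis
    using \<Psi> by (subst infsum_ennreal_eq_top_iff) auto
qed

section \<open>Dimension functions not dominated by Lebesgue measure\<close>

text \<open>
  Pigeonhole principle: each \<open>a\<close> attains its norm at some coordinate. On a slice in
  direction \<open>i0\<close>, the condition \<open>|a $ i0| = |a|\<close> gives the cubes the half side \<open>\<Psi> a / |a|\<close>.
\<close>

lemma exists_divergent_direction: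
  fixes t :: "int ^ 'n \<Rightarrow> real"
  assumes t0: "\<And>a. 0 \<le> t a" and div: "(\<Sum>\<^sub>\<infinity>a\<in>UNIV - {0}. ennreal (t a)) = \<infinity>"
  obtains i0 where "\<And>M. \<exists>F. finite F \<and>
    M \<le> (\<Sum>a\<in>F. if a \<noteq> 0 \<and> real_of_int \<bar>a $ i0\<bar> = sup_norm a then t a else 0)"
proof (rule ccontr)
  define u where "u i a = (if a \<noteq> 0 \<and> real_of_int \<bar>a $ i\<bar> = sup_norm a then t a else 0)" for i a
  have u0: "0 \<le> u i a" for i a using t0 by (simp add: u_def)
  assume "\<not> thesis"
  then have "\<forall>i. \<exists>M. \<forall>F. finite F \<longrightarrow> sum (u i) F < M"
    using that unfolding u_def by (meson not_le)
  then obtain M where M: "\<And>i F. finite F \<Longrightarrow> sum (u i) F < M i" by metis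
  obtain F where F: "finite F" "F \<subseteq> UNIV - {0}" "(\<Sum>i\<in>UNIV. M i) + 1 \<le> sum t F"
    using div infsum_ennreal_eq_top_iff[of "UNIV - {0}" t] t0 by blast
  have "sum t F \<le> (\<Sum>a\<in>F. \<Sum>i\<in>UNIV. u i a)"
  proof (rule sum_mono)
    fix a assume a: "a \<in> F"
    obtain i where "real_of_int \<bar>a $ i\<bar> = sup_norm a" using sup_norm_attained by blast
    then have "t a = u i a" using a F(2) by (auto simp: u_def)
    also have "\<dots> \<le> (\<Sum>i\<in>UNIV. u i a)" using u0 by (intro member_le_sum) auto
    finally show "t a \<le> (\<Sum>i\<in>UNIV. u i a)" .
  qed
  also have "\<dots> = (\<Sum>i\<in>UNIV. sum (u i) F)" by (rule sum.swap)
  also have "\<dots> \<le> (\<Sum>i\<in>UNIV. M i)" using M[OF F(1)] by (intro sum_mono less_imp_le)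
  finally show False using F(3) by simp
qed

text \<open>
  The mass transference principle on one slice. Here \<open>s a\<close> are the thinned terms of the series,
  \<open>\<rho> a \<le> \<Psi> a / |a|\<close> are the corresponding radii, and \<open>root CARD('m) (s a)\<close> is the function to which
  Schmidt's theorem is applied; its cubes have half side \<open>root CARD('m) (s a) / |a|\<close>, and the \<open>m\<close>-th
  power of this is \<open>g (\<rho> a)\<close>.

  Cubes are replaced by Euclidean balls: a small cube contains the ball of the same radius, and a large
  cube is contained in the ball of \<open>sqrt m\<close> times its half side.
\<close>

lemma hausdorff_measure_slice_infinite:
  fixes X :: "real ^ 'n ^ 'm" and b :: "real ^ 'm" and i0 :: "'n::finite"
    and \<Psi> s \<rho> :: "int ^ 'n \<Rightarrow> real"
  assumes \<Psi>: "\<And>e. 0 < e \<Longrightarrow> finite {a. e \<le> \<Psi> a}" "\<And>a. 0 \<le> \<Psi> a"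
    and s0: "\<And>a. 0 \<le> s a" and s_ex: "\<exists>a. 0 < s a"
    and s_dir: "\<And>a. 0 < s a \<Longrightarrow> a \<noteq> 0 \<and> real_of_int \<bar>a $ i0\<bar> = sup_norm a"
    and \<rho>: "\<And>a. 0 < s a \<Longrightarrow> 0 < \<rho> a \<and> \<rho> a \<le> \<Psi> a / sup_norm a \<and> g (\<rho> a) = s a / sup_norm a ^ CARD('m)"
    and g_mono: "\<And>x y. 0 < x \<Longrightarrow> x \<le> y \<Longrightarrow> g x \<le> g y"
    and g_anti: "\<And>x y. 0 < x \<Longrightarrow> x \<le> y \<Longrightarrow> g y / y ^ CARD('m) \<le> g x / x ^ CARD('m)"
    and g_small: "\<And>e. 0 < e \<Longrightarrow> \<exists>d>0. \<forall>x. 0 < x \<longrightarrow> x < d \<longrightarrow> g x < e"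
    and g_blowup: "\<And>M. \<exists>d>0. \<forall>x. 0 < x \<longrightarrow> x < d \<longrightarrow> M \<le> g x / x ^ CARD('m)"
    and X: "X \<in> box 0 (\<chi> j i. 1)"
    and null: "negligible {y. X + column_embed i0 y
       \<in> half_open_cube - well_approximable b (\<lambda>a. root CARD('m) (s a))}"
  shows "hausdorff_measure g {y. X + column_embed i0 y \<in> well_approximable b \<Psi>} = \<infinity>"
proof -
  \<comment> \<open>The balls are indexed by all pairs \<open>(a, p)\<close>; where \<open>s a = 0\<close> there is no ball, and those of \<open>a0\<close>
    are repeated instead.\<close>
  obtain a0 where a0: "0 < s a0" using s_ex by blast
  define \<alpha> where "\<alpha> a = (if 0 < s a then a else a0)" for a
  have \<alpha>: "0 < s (\<alpha> a)" for a using a0 by (simp add: \<alpha>_def)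
  have \<alpha>0: "\<alpha> a \<noteq> 0" "real_of_int \<bar>\<alpha> a $ i0\<bar> = sup_norm (\<alpha> a)" "0 < sup_norm (\<alpha> a)" "\<alpha> a $ i0 \<noteq> 0" for a
    using s_dir[OF \<alpha>[of a]] sup_norm_ge_1[of "\<alpha> a"] by auto
  define c :: "int ^ 'n \<Rightarrow> int ^ 'm \<Rightarrow> real ^ 'm" where
    "c a p = (\<chi> j. (real_of_int (p $ j) + b $ j - real_vec a \<bullet> X $ j) / real_of_int (a $ i0))" for a p
  define C where "C = (\<lambda>(a, p). c (\<alpha> a) p)"
  define r where "r = (\<lambda>(a, p :: int ^ 'm). \<rho> (\<alpha> a))"
  define R where "R = (\<lambda>(a, p :: int ^ 'm). sqrt CARD('m) * (root CARD('m) (s (\<alpha> a)) / sup_norm (\<alpha> a)))"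
  define L where "L = sqrt CARD('m) ^ CARD('m)"
  define \<Omega> where "\<Omega> = {y. X + column_embed i0 y \<in> box 0 (\<chi> j i. 1)}"
  have "continuous_on UNIV (\<lambda>y. X + column_embed i0 y)"
    by (intro continuous_intros continuous_on_column_embed)
  then have open\<Omega>: "open \<Omega>"
    unfolding \<Omega>_def using open_vimage[OF open_box] by (simp add: vimage_def)
  have "X + column_embed i0 0 = X" by (simp add: vec_eq_iff)
  then have "0 \<in> \<Omega>" using X by (simp add: \<Omega>_def)
  have fit: "shrunk_balls C r R g L \<Omega>"
  proof
    show "0 < r j" for j using \<rho>[OF \<alpha>] by (auto simp: r_def split: prod.split)
    show "0 < R j" for j using \<alpha> \<alpha>0 by (auto simp: R_def split: prod.split)
    show "0 < L" by (simp add: L_def)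
    show "R j ^ DIM(real ^ 'm) = L * g (r j)" for j
    proof (cases j)
      case (Pair a p)
      have "root CARD('m) (s (\<alpha> a)) ^ CARD('m) = s (\<alpha> a)" using s0 by (intro real_root_pow_pos2) auto
      then show ?thesis
        using \<rho>[OF \<alpha>[of a]] by (simp add: Pair R_def r_def L_def power_mult_distrib power_divide)
    qed
    show "g x \<le> g y" if "0 < x" "x \<le> y" for x y using that by (rule g_mono)
    show "g y / y ^ DIM(real ^ 'm) \<le> g x / x ^ DIM(real ^ 'm)" if "0 < x" "x \<le> y" for x y
      using g_anti[OF that] by simp
    show "\<exists>d>0. \<forall>x. 0 < x \<longrightarrow> x < d \<longrightarrow> g x < e" if "0 < e" for e using that by (rule g_small)
    show "\<exists>d>0. \<forall>x. 0 < x \<longrightarrow> x < d \<longrightarrow> M \<le> g x / x ^ DIM(real ^ 'm)" for M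
      using g_blowup[of M] by simp
    show "open \<Omega>" by (rule open\<Omega>)
    show "negligible {y \<in> \<Omega>. \<not> (\<forall>e>0. \<exists>j. r j < e \<and> y \<in> cball (C j) (R j))}"
    proof (rule negligible_subset[OF null], rule subsetI)
      fix y assume "y \<in> {y \<in> \<Omega>. \<not> (\<forall>e>0. \<exists>j. r j < e \<and> y \<in> cball (C j) (R j))}"
      then obtain e where y: "y \<in> \<Omega>" and e: "0 < e" and no: "\<not> (\<exists>j. r j < e \<and> y \<in> cball (C j) (R j))"
        by blast
      have "X + column_embed i0 y \<in> half_open_cube"
        using y open_unit_cube_subset by (auto simp: \<Omega>_def)
      moreover have "X + column_embed i0 y \<notin> well_approximable b (\<lambda>a. root CARD('m) (s a))"
      proof
        assume "X + column_embed i0 y \<in> well_approximable b (\<lambda>a. root CARD('m) (s a))"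
        then have "infinite ({a. \<forall>j. dist_nearest_int (real_vec a \<bullet> (X + column_embed i0 y) $ j - b $ j)
            < root CARD('m) (s a)} - {a. e \<le> \<Psi> a})"
          using \<Psi>(1)[OF e] by (intro Diff_infinite_finite) (auto simp: well_approximable_def)
        then obtain a where a: "\<And>j. dist_nearest_int (real_vec a \<bullet> (X + column_embed i0 y) $ j - b $ j)
            < root CARD('m) (s a)" "\<Psi> a < e"
          by (metis (mono_tags, lifting) DiffD1 DiffD2 finite.emptyI equals0I mem_Collect_eq not_le)
        have "0 \<le> dist_nearest_int (real_vec a \<bullet> (X + column_embed i0 y) $ j - b $ j)" for j
          by (simp add: dist_nearest_int_def infdist_nonneg)
        then have "0 < root CARD('m) (s a)" using a(1) by (meson le_less_trans)
        then have sa: "0 < s a" by simp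
        then have \<alpha>a: "\<alpha> a = a" by (simp add: \<alpha>_def)
        have a0: "a $ i0 \<noteq> 0" "real_of_int \<bar>a $ i0\<bar> = sup_norm a" "1 \<le> sup_norm a"
          using \<alpha>0[of a] s_dir[OF sa] sup_norm_ge_1[of a] by (auto simp: \<alpha>a)
        obtain p :: "int ^ 'm" where p: "\<And>j. \<bar>y $ j - c a p $ j\<bar> < root CARD('m) (s a) / sup_norm a"
          using a(1) approximable_on_slice_iff[OF a0(1), of X y b "root CARD('m) (s a)"]
          unfolding a0(2) c_def by auto
        have "norm (y - c a p) \<le> R (a, p)"
          unfolding R_def \<alpha>a prod.case
          using p a0 \<open>0 < root CARD('m) (s a)\<close> by (intro norm_le_sqrt_card) (auto intro: less_imp_le)
        then have "y \<in> cball (C (a, p)) (R (a, p))"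
          by (simp add: C_def \<alpha>a dist_norm norm_minus_commute)
        moreover have "r (a, p) < e"
        proof -
          have "r (a, p) \<le> \<Psi> a / sup_norm a" using \<rho>[OF sa] by (simp add: r_def \<alpha>a)
          also have "\<dots> \<le> \<Psi> a / 1" using a0(3) \<Psi>(2) by (intro divide_left_mono) auto
          finally show ?thesis using a(2) by simp
        qed
        ultimately show False using no by blast
      qed
      ultimately show "y \<in> {y. X + column_embed i0 y
        \<in> half_open_cube - well_approximable b (\<lambda>a. root CARD('m) (s a))}" by blast
    qed
  qed
  have "{y \<in> \<Omega>. \<forall>e>0. \<exists>j. r j < e \<and> y \<in> ball (C j) (r j)}
      \<subseteq> {y. X + column_embed i0 y \<in> well_approximable b \<Psi>}"
  proof clarify
    fix y assume y: "y \<in> \<Omega>" and lim: "\<forall>e>0. \<exists>j. r j < e \<and> y \<in> ball (C j) (r j)"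
    let ?S = "{a. \<forall>j. dist_nearest_int (real_vec a \<bullet> (X + column_embed i0 y) $ j - b $ j) < \<Psi> a}"
    have inS: "\<alpha> a \<in> ?S" if "y \<in> ball (C (a, p)) (r (a, p))" for a p
    proof -
      have "\<bar>y $ j - c (\<alpha> a) p $ j\<bar> < \<Psi> (\<alpha> a) / sup_norm (\<alpha> a)" for j
      proof -
        have "\<bar>(y - c (\<alpha> a) p) $ j\<bar> \<le> norm (y - c (\<alpha> a) p)" by (rule component_le_norm_cart)
        also have "\<dots> < \<rho> (\<alpha> a)" using that by (simp add: C_def r_def dist_norm norm_minus_commute)
        also have "\<dots> \<le> \<Psi> (\<alpha> a) / sup_norm (\<alpha> a)" using \<rho>[OF \<alpha>] by blast
        finally show ?thesis by simp
      qed
      then have "\<exists>p :: int ^ 'm. \<forall>j. \<bar>y $ j - (real_of_int (p $ j) + b $ j - real_vec (\<alpha> a) \<bullet> X $ j)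
          / real_of_int (\<alpha> a $ i0)\<bar> < \<Psi> (\<alpha> a) / real_of_int \<bar>\<alpha> a $ i0\<bar>"
        unfolding \<alpha>0(2) by (intro exI[of _ p]) (simp add: c_def)
      then show ?thesis using approximable_on_slice_iff[OF \<alpha>0(4)[of a]] by blast
    qed
    have "infinite ?S"
    proof
      assume fin: "finite ?S"
      let ?T = "insert 1 (\<rho> ` (?S \<inter> range \<alpha>))"
      have "0 < Min ?T" using fin \<rho>[OF \<alpha>] by auto
      then obtain q where q: "r q < Min ?T" "y \<in> ball (C q) (r q)" using lim by blast
      obtain a p where "q = (a, p)" by (cases q)
      then have j: "r (a, p) < Min ?T" "y \<in> ball (C (a, p)) (r (a, p))" using q by simp_all
      have "Min ?T \<le> \<rho> (\<alpha> a)" using fin inS[OF j(2)] by (intro Min_le) auto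
      then show False using j(1) by (simp add: r_def)
    qed
    moreover have "X + column_embed i0 y \<in> half_open_cube"
      using y open_unit_cube_subset by (auto simp: \<Omega>_def)
    ultimately show "X + column_embed i0 y \<in> well_approximable b \<Psi>"
      by (simp add: well_approximable_def)
  qed
  then have "hausdorff_measure g {y \<in> \<Omega>. \<forall>e>0. \<exists>j. r j < e \<and> y \<in> ball (C j) (r j)}
      \<le> hausdorff_measure g {y. X + column_embed i0 y \<in> well_approximable b \<Psi>}"
    by (rule hausdorff_measure_mono)
  moreover have "hausdorff_measure g {y \<in> \<Omega>. \<forall>e>0. \<exists>j. r j < e \<and> y \<in> ball (C j) (r j)} = \<infinity>"
    using \<open>0 \<in> \<Omega>\<close> by (intro shrunk_balls.hausdorff_measure_shrunk_limsup[OF fit]) blast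
  ultimately show ?thesis by (simp add: top_unique)
qed


text \<open>
  The slicing argument. The intermediate value theorem gives a radius \<open>\<rho> a\<close>, at most
  \<open>\<Psi> a / |a|\<close>, for each thinned term \<open>s a\<close>.
\<close>

lemma hausdorff_measure_well_approximable_infinite:
  fixes b :: "real ^ 'm::finite" and \<Psi> :: "int ^ 'n::finite \<Rightarrow> real" and f :: "real \<Rightarrow> real"
  defines "g \<equiv> reduced_function CARD('n) CARD('m) f"
  assumes schmidt: "\<And>\<Psi> :: int ^ 'n \<Rightarrow> real.
      (\<forall>a. 0 \<le> \<Psi> a) \<Longrightarrow> tends_to_zero \<Psi> \<Longrightarrow>
      (\<Sum>\<^sub>\<infinity>a\<in>UNIV. ennreal (\<Psi> a ^ CARD('m))) = \<infinity> \<Longrightarrow>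
      emeasure lebesgue (well_approximable b \<Psi>) = 1"
    and \<Psi>: "\<And>a. 0 \<le> \<Psi> a" "tends_to_zero \<Psi>"
    and g: "dimension_function g"
    and anti: "\<And>x y. 0 < x \<Longrightarrow> x \<le> y \<Longrightarrow>
        f y / y ^ (CARD('n) * CARD('m)) \<le> f x / x ^ (CARD('n) * CARD('m))"
    and blowup: "\<And>M. \<exists>d>0. \<forall>x. 0 < x \<longrightarrow> x < d \<longrightarrow> M \<le> f x / x ^ (CARD('n) * CARD('m))"
    and div: "(\<Sum>\<^sub>\<infinity>a\<in>UNIV - {0}. ennreal (g (\<Psi> a / sup_norm a) * sup_norm a ^ CARD('m))) = \<infinity>"
  shows "hausdorff_measure f (well_approximable b \<Psi> :: (real ^ 'n ^ 'm) set) = \<infinity>"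
proof -
  let ?m = "CARD('m)" and ?l = "(CARD('n) - 1) * CARD('m)"
  have split_dim: "CARD('n) * ?m = ?l + ?m"
    by (cases "CARD('n)") auto
  have g_f: "g x / x ^ ?m = f x / x ^ (CARD('n) * ?m)" if "0 < x" for x
    using that by (simp add: g_def reduced_function_def split_dim power_add)
  have f_g: "f x = x ^ ?l * g x" if "0 < x" for x
    using that by (simp add: g_def reduced_function_def)
  have g0: "g 0 = 0" by (simp add: g_def reduced_function_def)
  have g_nn: "0 \<le> g x" if "0 \<le> x" for x using g that by (simp add: dimension_function_def)
  have g_mono: "g x \<le> g y" if "0 < x" "x \<le> y" for x y
    using g that by (auto simp: dimension_function_def mono_on_def)
  have g_small: "\<exists>d>0. \<forall>x. 0 < x \<longrightarrow> x < d \<longrightarrow> g x < e" if "0 < e" for e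
  proof -
    have "(g \<longlongrightarrow> 0) (at_right 0)" using g by (simp add: dimension_function_def)
    then have "\<forall>\<^sub>F x in at_right 0. g x < e" using that by (rule order_tendstoD(2))
    then show ?thesis by (auto simp: eventually_at_right_field)
  qed
  have fin\<Psi>: "finite {a. e \<le> \<Psi> a}" if "0 < e" for e
    using \<Psi> that tends_to_zero_iff_finite[of \<Psi>] by blast
  define t where "t a = g (\<Psi> a / sup_norm a) * sup_norm a ^ ?m" for a
  have sn: "0 \<le> sup_norm a" for a :: "int ^ 'n" by (simp add: sup_norm_def infnorm_pos_le)
  have t0: "0 \<le> t a" for a using g_nn \<Psi>(1) sn by (simp add: t_def)
  obtain i0 where i0: "\<And>M. \<exists>F. finite F \<and>
      M \<le> (\<Sum>a\<in>F. if a \<noteq> 0 \<and> real_of_int \<bar>a $ i0\<bar> = sup_norm a then t a else 0)"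
    by (rule exists_divergent_direction[of t]) (use t0 div in \<open>auto simp: t_def\<close>)
  have nn: "0 \<le> (if a \<noteq> 0 \<and> real_of_int \<bar>a $ i0\<bar> = sup_norm a then t a else 0)" for a
    using t0 by simp
  obtain s where s0: "\<And>a. 0 \<le> s a"
    and s_le: "\<And>a. s a \<le> (if a \<noteq> 0 \<and> real_of_int \<bar>a $ i0\<bar> = sup_norm a then t a else 0)"
    and s_fin: "\<And>e. 0 < e \<Longrightarrow> finite {a. e \<le> s a}" and s_div: "\<And>M. \<exists>F. finite F \<and> M \<le> sum s F"
    using divergent_series_thinning[OF nn i0] by blast
  have s_dir: "a \<noteq> 0 \<and> real_of_int \<bar>a $ i0\<bar> = sup_norm a" and s_t: "s a \<le> t a" if "0 < s a" for a
    using s_le[of a] that by (auto split: if_splits)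
  have "\<exists>a. 0 < s a"
  proof (rule ccontr)
    assume "\<not> (\<exists>a. 0 < s a)"
    then have "sum s F \<le> 0" for F by (intro sum_nonpos) (simp add: not_less)
    then show False using s_div[of 1] by (meson not_one_le_zero order.trans)
  qed
  have "\<exists>x. 0 < x \<and> x \<le> \<Psi> a / sup_norm a \<and> g x = s a / sup_norm a ^ ?m" if sa: "0 < s a" for a
  proof -
    have n1: "1 \<le> sup_norm a" using s_dir[OF sa] sup_norm_ge_1 by blast
    then have np: "0 < sup_norm a ^ ?m" by simp
    have "\<exists>x\<ge>0. x \<le> \<Psi> a / sup_norm a \<and> g x = s a / sup_norm a ^ ?m"
    proof (rule IVT')
      show "g 0 \<le> s a / sup_norm a ^ ?m" using sa np by (simp add: g0)
      show "s a / sup_norm a ^ ?m \<le> g (\<Psi> a / sup_norm a)"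
        using s_t[OF sa] np by (simp add: t_def pos_divide_le_eq)
      show "0 \<le> \<Psi> a / sup_norm a" using \<Psi>(1) n1 by simp
      show "continuous_on {0..\<Psi> a / sup_norm a} g"
        using g by (auto simp: dimension_function_def intro: continuous_on_subset)
    qed
    then obtain x where x: "0 \<le> x" "x \<le> \<Psi> a / sup_norm a" "g x = s a / sup_norm a ^ ?m" by blast
    have "x \<noteq> 0" using x(3) sa n1 g0 by auto
    then show ?thesis using x by (intro exI[of _ x]) auto
  qed
  then obtain \<rho> where \<rho>: "\<And>a. 0 < s a \<Longrightarrow> 0 < \<rho> a \<and> \<rho> a \<le> \<Psi> a / sup_norm a \<and> g (\<rho> a) = s a / sup_norm a ^ ?m"
    by metis
  let ?\<Psi>' = "\<lambda>a. root ?m (s a)"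
  have full: "emeasure lebesgue (well_approximable b ?\<Psi>') = 1"
  proof (rule schmidt)
    show nn': "\<forall>a. 0 \<le> ?\<Psi>' a" using s0 by simp
    have pw: "?\<Psi>' a ^ ?m = s a" for a using s0 by (intro real_root_pow_pos2) auto
    show "tends_to_zero ?\<Psi>'"
    proof (subst tends_to_zero_iff_finite)
      show "\<forall>e>0. finite {a. e \<le> ?\<Psi>' a}"
      proof (intro allI impI)
        fix e :: real assume e: "0 < e"
        have "{a. e \<le> ?\<Psi>' a} \<subseteq> {a. e ^ ?m \<le> s a}"
          using e pw by (auto dest: power_mono[of e _ ?m])
        then show "finite {a. e \<le> ?\<Psi>' a}" by (rule finite_subset) (use e in \<open>auto intro: s_fin\<close>)
      qed
    qed (use nn' in blast)
    show "(\<Sum>\<^sub>\<infinity>a\<in>UNIV. ennreal (?\<Psi>' a ^ ?m)) = \<infinity>"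
      unfolding pw using s0 s_div by (subst infsum_ennreal_eq_top_iff) auto
  qed
  have "well_approximable b ?\<Psi>' \<subseteq> half_open_cube" by (auto simp: well_approximable_def)
  from AE_slices_negligible[OF negligible_cube_minus_full[OF full this], of i0]
  have "AE X in lborel. X \<in> box 0 (\<chi> j i. 1) \<longrightarrow>
      hausdorff_measure g {y. X + column_embed i0 y \<in> well_approximable b \<Psi>} = \<infinity>"
  proof eventually_elim
    case (elim X)
    show ?case
    proof
      assume X: "X \<in> box 0 (\<chi> j i. 1)"
      show "hausdorff_measure g {y. X + column_embed i0 y \<in> well_approximable b \<Psi>} = \<infinity>"
      proof (rule hausdorff_measure_slice_infinite[of \<Psi> s i0 \<rho> g, OF fin\<Psi> \<Psi>(1) s0 _ s_dir \<rho> g_mono _ g_small _ X elim])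
        show "g y / y ^ ?m \<le> g x / x ^ ?m" if "0 < x" "x \<le> y" for x y
          using anti[OF that] g_f that by simp
        show "\<exists>d>0. \<forall>x. 0 < x \<longrightarrow> x < d \<longrightarrow> M \<le> g x / x ^ ?m" for M
          using blowup[of M] g_f by metis
      qed (use \<open>\<exists>a. 0 < s a\<close> in auto)
    qed
  qed
  then show ?thesis
    by (rule hausdorff_measure_infinite_if_slices[rotated]) (use f_g g_nn in auto)
qed

section \<open>Schmidt's theorem implies its version for Hausdorff measures\<close>

theorem theorem2:
  fixes b :: "real ^ 'm::finite"
  assumes dims: "CARD('n::finite) + CARD('m) > 2"
    and schmidt: "\<forall>\<Psi> :: int ^ 'n \<Rightarrow> real.
      (\<forall>a. 0 \<le> \<Psi> a) \<longrightarrow> tends_to_zero \<Psi> \<longrightarrow>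
      (\<Sum>\<^sub>\<infinity>a\<in>UNIV. ennreal (\<Psi> a ^ CARD('m))) = \<infinity> \<longrightarrow>
      emeasure lebesgue (well_approximable b \<Psi>) = 1"
  shows "\<forall>(\<Psi> :: int ^ 'n \<Rightarrow> real) (f :: real \<Rightarrow> real).
      (\<forall>a. 0 \<le> \<Psi> a) \<longrightarrow> tends_to_zero \<Psi> \<longrightarrow>
      dimension_function f \<longrightarrow>
      (mono_on {0<..} (\<lambda>r. f r / r ^ (CARD('n) * CARD('m))) \<or>
       antimono_on {0<..} (\<lambda>r. f r / r ^ (CARD('n) * CARD('m)))) \<longrightarrow>
      dimension_function (reduced_function CARD('n) CARD('m) f) \<longrightarrow>
      (\<Sum>\<^sub>\<infinity>a\<in>UNIV - {0}. ennreal
         (reduced_function CARD('n) CARD('m) f (\<Psi> a / sup_norm a) * sup_norm a ^ CARD('m))) = \<infinity> \<longrightarrow>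
      hausdorff_measure f (well_approximable b \<Psi>) =
      hausdorff_measure f (half_open_cube :: (real ^ 'n ^ 'm) set)"
proof (intro allI impI)
  fix \<Psi> :: "int ^ 'n \<Rightarrow> real" and f :: "real \<Rightarrow> real"
  let ?k = "CARD('n) * CARD('m)" and ?l = "(CARD('n) - 1) * CARD('m)" and ?m = "CARD('m)"
  let ?g = "reduced_function CARD('n) CARD('m) f"
  assume \<Psi>: "\<forall>a. 0 \<le> \<Psi> a" "tends_to_zero \<Psi>" and f: "dimension_function f"
    and mono: "mono_on {0<..} (\<lambda>r. f r / r ^ ?k) \<or> antimono_on {0<..} (\<lambda>r. f r / r ^ ?k)"
    and g: "dimension_function ?g"
    and div: "(\<Sum>\<^sub>\<infinity>a\<in>UNIV - {0}. ennreal (?g (\<Psi> a / sup_norm a) * sup_norm a ^ ?m)) = \<infinity>"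
  have f_nn: "0 \<le> f x" if "0 \<le> x" for x using f that by (simp add: dimension_function_def)
  have W: "well_approximable b \<Psi> \<subseteq> (half_open_cube :: (real ^ 'n ^ 'm) set)"
    by (auto simp: well_approximable_def)
  show "hausdorff_measure f (well_approximable b \<Psi>) =
      hausdorff_measure f (half_open_cube :: (real ^ 'n ^ 'm) set)"
  proof (cases "\<exists>K r0. 0 < r0 \<and> (\<forall>x. 0 < x \<longrightarrow> x \<le> r0 \<longrightarrow> f x \<le> K * x ^ ?k)")
    case True
    then obtain K r0 where r0: "0 < r0" and K: "\<And>x. 0 < x \<Longrightarrow> x \<le> r0 \<Longrightarrow> f x \<le> K * x ^ ?k" by blast
    have split_dim: "?k = ?l + ?m" by (cases "CARD('n)") auto
    have g_le: "?g x \<le> K * x ^ ?m" if "0 \<le> x" "x \<le> r0" for x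
    proof (cases "x = 0")
      case False
      have "x ^ ?k = x ^ ?m * x ^ ?l" by (simp only: split_dim power_add) (rule mult.commute)
      then have "f x \<le> K * x ^ ?m * x ^ ?l"
        using K[of x] that \<open>x \<noteq> 0\<close> by (simp only: mult.assoc)
      then show ?thesis using False that by (simp add: reduced_function_def pos_divide_le_eq)
    qed (simp add: reduced_function_def power_0_left)
    have "(\<Sum>\<^sub>\<infinity>a\<in>UNIV. ennreal (\<Psi> a ^ ?m)) = \<infinity>"
    proof (rule divergence_of_power_series[of \<Psi> r0 "\<lambda>a. ?g (\<Psi> a / sup_norm a) * sup_norm a ^ ?m" K])
      have "finite {a. r0 \<le> \<Psi> a}" using \<Psi> r0 tends_to_zero_iff_finite[of \<Psi>] by blast
      then show "finite {a. r0 < \<Psi> a}" by (rule finite_subset[rotated]) auto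
      show "?g (\<Psi> a / sup_norm a) * sup_norm a ^ ?m \<le> K * \<Psi> a ^ ?m" if "a \<noteq> 0" "\<Psi> a \<le> r0" for a
      proof -
        have n: "1 \<le> sup_norm a" using that(1) by (rule sup_norm_ge_1)
        have "\<Psi> a / sup_norm a \<le> \<Psi> a / 1" using n \<Psi>(1) by (intro divide_left_mono) auto
        then have "?g (\<Psi> a / sup_norm a) \<le> K * (\<Psi> a / sup_norm a) ^ ?m"
          using n \<Psi>(1) that(2) by (intro g_le) auto
        then have "?g (\<Psi> a / sup_norm a) * sup_norm a ^ ?m \<le> K * (\<Psi> a / sup_norm a) ^ ?m * sup_norm a ^ ?m"
          using n by (intro mult_right_mono) auto
        also have "\<dots> = K * \<Psi> a ^ ?m" using n by (simp add: power_divide)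
        finally show ?thesis .
      qed
      show "0 \<le> ?g (\<Psi> a / sup_norm a) * sup_norm a ^ ?m" for a
        using g \<Psi>(1) by (simp add: dimension_function_def sup_norm_def infnorm_pos_le)
    qed (use \<Psi> div in auto)
    then have "emeasure lebesgue (well_approximable b \<Psi>) = 1" using schmidt \<Psi> by blast
    then show ?thesis
      by (rule hausdorff_measure_full_subset[OF _ W r0]) (use f_nn K in auto)
  next
    case False
    have large: "\<exists>x. 0 < x \<and> x \<le> r0 \<and> M < f x / x ^ ?k" if "0 < r0" for M r0
    proof -
      have "\<not> (\<forall>x. 0 < x \<longrightarrow> x \<le> r0 \<longrightarrow> f x \<le> M * x ^ ?k)" using False that by blast
      then obtain x where x: "0 < x" "x \<le> r0" "M * x ^ ?k < f x" by (auto simp: not_le)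
      then have "M < f x / x ^ ?k" by (simp add: pos_less_divide_eq)
      with x show ?thesis by blast
    qed
    have "\<not> mono_on {0<..} (\<lambda>r. f r / r ^ ?k)"
    proof
      assume *: "mono_on {0<..} (\<lambda>r. f r / r ^ ?k)"
      obtain x where x: "0 < x" "x \<le> 1" "f 1 < f x / x ^ ?k" using large[of 1 "f 1"] by auto
      have "f x / x ^ ?k \<le> f 1 / 1 ^ ?k"
        using x by (intro mono_onD[OF *]) auto
      then show False using x(3) by simp
    qed
    then have anti: "f y / y ^ ?k \<le> f x / x ^ ?k" if "0 < x" "x \<le> y" for x y
      using mono that by (auto simp: monotone_on_def)
    have blowup: "\<exists>d>0. \<forall>x. 0 < x \<longrightarrow> x < d \<longrightarrow> M \<le> f x / x ^ ?k" for M
    proof -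
      obtain z where z: "0 < z" "M < f z / z ^ ?k" using large[of 1 M] by auto
      have "M \<le> f x / x ^ ?k" if "0 < x" "x < z" for x
        using anti[of x z] that z(2) by linarith
      then show ?thesis using z(1) by blast
    qed
    have "hausdorff_measure f (well_approximable b \<Psi> :: (real ^ 'n ^ 'm) set) = \<infinity>"
      by (rule hausdorff_measure_well_approximable_infinite[OF _ _ \<Psi>(2) g anti blowup div])
        (use schmidt \<Psi>(1) in auto)
    then show ?thesis using hausdorff_measure_mono[OF W, of f] by (simp add: top_unique)
  qed
qed

end
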